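(* Let $Q$ be an extended Dynkin quiver with extending vertex $o\in I$, and let $\mathbf c$ be the adjacency matrix of the double $\overline Q$. Then $$\prod_{r\ge1}\det(\mathbf 1-t^r\cdot\mathbf c+t^{2r}\cdot\mathbf 1)=\prod_{k\ge1}(1-t^k)^{\varphi_k(\mathbf c)_{oo}}$$ as formal power series in $t$.
   Context: $Q$ is a finite quiver with vertex set $I$ whose underlying graph is a (connected) affine Dynkin diagram of type $\tilde A,\tilde D,\tilde E$; an extending vertex is the additional vertex whose removal leaves the corresponding finite Dynkin diagram. The double $\overline Q$ is obtained by replacing each edge of $Q$ by a pair of oppositely oriented edges; $\mathbf c=\|\mathbf c_{ij}\|$, where $\mathbf c_{ij}$ is the number of edges $i\to j$ in $\overline Q$. $\mathbf 1$ is the identity $I\times I$-matrix. For $k\ge1$, $\varphi_k\in\mathbb C[x]$ is the (Chebyshev-type) polynomial determined by $\varphi_k(2\cos z)=2\cos(kz)$, equivalently $\frac{1-t^2}{1-tx+t^2}=1+\sum_{k\ge1}\varphi_k(x)t^k$. $\varphi_k(\mathbf c)_{oo}$ is the $(o,o)$ entry (an integer) of the matrix $\varphi_k(\mathbf c)$. *)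

theory Defs
  imports
    "HOL-Analysis.Analysis"
    "HOL-Library.Multiset"
    "HOL-Computational_Algebra.Computational_Algebra"
    "Graph_Theory.Digraph"
begin

no_notation fps_nth (infixl "$" 75)

section \<open>Dynkin and extended Dynkin diagrams\<close>

text \<open>
  A diagram is the multiset of its edges, an edge being the set of its endpoints (a singleton for
  a loop). The rank-\<open>n\<close> Dynkin diagrams have vertex set \<open>{1..n}\<close>, labelled as in Bourbaki; in the
  extended diagrams the additional vertex is \<open>0\<close>.
\<close>

datatype dynkin_type = Type_A nat | Type_D nat | Type_E nat

fun rank :: "dynkin_type \<Rightarrow> nat" where
  "rank (Type_A n) = n"
| "rank (Type_D n) = n"
| "rank (Type_E n) = n"

text \<open>
  \<open>Type_A 0\<close> is allowed: its Dynkin diagram is empty and its extended diagram is a single vertex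
  with one loop.
\<close>

fun valid_type :: "dynkin_type \<Rightarrow> bool" where
  "valid_type (Type_A n) \<longleftrightarrow> True"
| "valid_type (Type_D n) \<longleftrightarrow> 4 \<le> n"
| "valid_type (Type_E n) \<longleftrightarrow> n \<in> {6, 7, 8}"

text \<open>The path \<open>a - (a + 1) - \<dots> - b\<close>.\<close>

definition path_edges :: "nat \<Rightarrow> nat \<Rightarrow> nat set multiset" where
  "path_edges a b = image_mset (\<lambda>i. {i, i + 1}) (mset_set {a..<b})"

fun dynkin_edges :: "dynkin_type \<Rightarrow> nat set multiset" where
  "dynkin_edges (Type_A n) = path_edges 1 n"
| "dynkin_edges (Type_D n) = path_edges 1 (n - 1) + {# {n - 2, n} #}"
| "dynkin_edges (Type_E n) = path_edges 3 n + {# {1, 3}, {2, 4} #}"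

text \<open>
  The edges at the additional vertex. For \<open>Type_A 1\<close> the two edges coincide, giving a double edge.
\<close>

fun extending_edges :: "dynkin_type \<Rightarrow> nat set multiset" where
  "extending_edges (Type_A n) = (if n = 0 then {# {0} #} else {# {0, 1}, {0, n} #})"
| "extending_edges (Type_D n) = {# {0, 2} #}"
| "extending_edges (Type_E n) = {# {0, if n = 6 then 2 else if n = 7 then 1 else 8} #}"

definition extended_dynkin_edges :: "dynkin_type \<Rightarrow> nat set multiset" where
  "extended_dynkin_edges X = dynkin_edges X + extending_edges X"

lemma extended_dynkin_remove_extending_vertex:
  assumes "valid_type X"
  shows "filter_mset (\<lambda>e. 0 \<notin> e) (extended_dynkin_edges X) = dynkin_edges X"
proof -
  have "filter_mset (\<lambda>e. 0 \<notin> e) (path_edges a b) = path_edges a b" if "1 \<le> a" for a b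
    using that by (auto simp: path_edges_def filter_mset_eq_conv)
  then show ?thesis
    using assms by (cases X) (auto simp: extended_dynkin_edges_def)
qed

section \<open>Quivers\<close>

text \<open>A quiver is a \<open>pre_digraph\<close>: the arc \<open>a\<close> goes from \<open>tail Q a\<close> to \<open>head Q a\<close>.\<close>

definition underlying_edges :: "('v, 'e) pre_digraph \<Rightarrow> 'v set multiset" where
  "underlying_edges Q = image_mset (\<lambda>a. {tail Q a, head Q a}) (mset_set (arcs Q))"

text \<open>\<open>f\<close> is an isomorphism from the underlying graph of \<open>Q\<close> to the extended diagram of type \<open>X\<close>.\<close>

definition extended_dynkin_labelling ::
    "('v, 'e) pre_digraph \<Rightarrow> dynkin_type \<Rightarrow> ('v \<Rightarrow> nat) \<Rightarrow> bool" where
  "extended_dynkin_labelling Q X f \<longleftrightarrow>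
     valid_type X \<and> bij_betw f (verts Q) {0..rank X} \<and>
     image_mset ((`) f) (underlying_edges Q) = extended_dynkin_edges X"

definition extended_dynkin_quiver :: "('v, 'e) pre_digraph \<Rightarrow> bool" where
  "extended_dynkin_quiver Q \<longleftrightarrow> fin_digraph Q \<and> (\<exists>X f. extended_dynkin_labelling Q X f)"

definition extending_vertex :: "('v, 'e) pre_digraph \<Rightarrow> 'v \<Rightarrow> bool" where
  "extending_vertex Q v \<longleftrightarrow>
     v \<in> verts Q \<and> (\<exists>X f. extended_dynkin_labelling Q X f \<and> f v = 0)"

definition double_quiver :: "('v, 'e) pre_digraph \<Rightarrow> ('v, 'e + 'e) pre_digraph" where
  "double_quiver Q =
     \<lparr>verts = verts Q, arcs = arcs Q <+> arcs Q,
      tail = case_sum (tail Q) (head Q), head = case_sum (head Q) (tail Q)\<rparr>"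

definition adjacency_matrix :: "('v::finite, 'e) pre_digraph \<Rightarrow> 'a::semiring_1 ^ 'v ^ 'v" where
  "adjacency_matrix Q = (\<chi> i j. of_nat (card {a \<in> arcs Q. tail Q a = i \<and> head Q a = j}))"

section \<open>Polynomials in a square matrix\<close>

text \<open>The operations \<open>*\<close> and \<open>^\<close> on \<open>'a ^ 'n ^ 'n\<close> are componentwise, so they are not used here.\<close>

definition scale_matrix :: "'a::times \<Rightarrow> 'a ^ 'n ^ 'm \<Rightarrow> 'a ^ 'n ^ 'm" where
  "scale_matrix t A = (\<chi> i j. t * A $ i $ j)"

definition matrix_power :: "'a::semiring_1 ^ 'n ^ 'n \<Rightarrow> nat \<Rightarrow> 'a ^ 'n ^ 'n" where
  "matrix_power A k = (((**) A) ^^ k) (mat 1)"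

definition poly_matrix :: "'a::comm_semiring_1 poly \<Rightarrow> 'a ^ 'n ^ 'n \<Rightarrow> 'a ^ 'n ^ 'n" where
  "poly_matrix p A = (\<Sum>i\<le>degree p. scale_matrix (coeff p i) (matrix_power A i))"

section \<open>The Chebyshev-type polynomials\<close>

definition phi :: "nat \<Rightarrow> complex poly" where
  "phi k = (THE p. \<forall>z. poly p (2 * cos z) = 2 * cos (of_nat k * z))"

fun phi_rec :: "nat \<Rightarrow> complex poly" where
  "phi_rec 0 = [:2:]"
| "phi_rec (Suc 0) = [:0, 1:]"
| "phi_rec (Suc (Suc k)) = [:0, 1:] * phi_rec (Suc k) - phi_rec k"

lemma poly_phi_rec: "poly (phi_rec k) (2 * cos z) = 2 * cos (of_nat k * z)"
proof (induction k rule: phi_rec.induct)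
  case (3 k)
  define w where "w = of_nat (Suc k) * z"
  have 1: "of_nat (Suc (Suc k)) * z = w + z" "of_nat k * z = w - z"
    by (simp_all add: w_def algebra_simps)
  show ?case
    using 3 unfolding 1 w_def[symmetric]
    by (simp add: cos_add cos_diff algebra_simps)
qed simp_all

lemma phi_unique:
  fixes p q :: "complex poly"
  assumes "\<And>z. poly p (2 * cos z) = poly q (2 * cos z)"
  shows "p = q"
proof -
  have "poly p x = poly q x" for x
  proof -
    have "cos (Arccos (x / 2)) = x / 2" by simp
    then show ?thesis using assms[of "Arccos (x / 2)"] by simp
  qed
  then show ?thesis by (simp add: poly_eq_poly_eq_iff[symmetric] fun_eq_iff)
qed

lemma phi_eq_phi_rec: "phi k = phi_rec k"
  unfolding phi_def
proof (rule the_equality)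
  show "\<forall>z. poly (phi_rec k) (2 * cos z) = 2 * cos (of_nat k * z)"
    by (simp add: poly_phi_rec)
  show "p = phi_rec k" if "\<forall>z. poly p (2 * cos z) = 2 * cos (of_nat k * z)" for p
    by (rule phi_unique) (simp add: that poly_phi_rec)
qed

lemma poly_phi: "poly (phi k) (2 * cos z) = 2 * cos (of_nat k * z)"
  by (simp add: phi_eq_phi_rec poly_phi_rec)

lemma coeff_phi_in_Ints: "coeff (phi k) i \<in> \<int>"
proof -
  have "coeff (phi_rec k) i \<in> \<int>" for i
    by (induction k arbitrary: i rule: phi_rec.induct)
       (auto simp: coeff_pCons split: nat.splits)
  then show ?thesis by (simp add: phi_eq_phi_rec)
qed

text \<open>
  The entry \<open>\<phi>\<^sub>k(\<^bold>c)\<^sub>v\<^sub>v\<close> as an integer; see \<open>of_int_phi_entry\<close> below, which shows that taking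
  the floor of the real part loses nothing.
\<close>

definition phi_entry :: "nat \<Rightarrow> complex ^ 'v ^ 'v \<Rightarrow> 'v::finite \<Rightarrow> int" where
  "phi_entry k A v = \<lfloor>Re (poly_matrix (phi k) A $ v $ v)\<rfloor>"

lemma of_int_phi_entry:
  assumes "\<And>i j. A $ i $ j \<in> \<int>"
  shows "of_int (phi_entry k A v) = poly_matrix (phi k) A $ v $ v"
proof -
  have "matrix_power A n $ i $ j \<in> \<int>" for n i j
    by (induction n arbitrary: i j)
       (auto simp: matrix_power_def mat_def matrix_matrix_mult_def intro!: Ints_sum Ints_mult assms)
  then have "poly_matrix (phi k) A $ v $ v \<in> \<int>"
    by (auto simp: poly_matrix_def scale_matrix_def intro!: Ints_sum Ints_mult coeff_phi_in_Ints)
  then show ?thesis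
    by (auto simp: phi_entry_def elim!: Ints_cases)
qed

lemma adjacency_matrix_in_Ints: "(adjacency_matrix Q :: complex ^ 'v ^ 'v::finite) $ i $ j \<in> \<int>"
  by (simp add: adjacency_matrix_def)

end

theory Submission
  imports Defs
begin

text \<open>
  Write \<open>A t = 1 - t c + t\<^sup>2\<close>. The recursion for \<open>\<phi>\<^sub>k\<close> gives
  \<open>A t (\<Sum>\<^sub>k\<^sub>\<ge>\<^sub>0 \<phi>\<^sub>k(c) e\<^sub>o t\<^sup>k - e\<^sub>o) = (1 - t\<^sup>2) e\<^sub>o\<close>, so both sides of the identity are governed by \<open>A t\<close>:
  the left by its determinant, the right by the \<open>(o,o)\<close> entry of its inverse. For a diagram with
  extending vertex \<open>o\<close> there are lists \<open>ms\<close> and \<open>ns\<close> such that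
  \<open>det (A t) = \<Prod>\<^sub>m\<^sub>\<in>\<^sub>m\<^sub>s (1 - t\<^sup>m) / \<Prod>\<^sub>m\<^sub>\<in>\<^sub>n\<^sub>s (1 - t\<^sup>m)\<close> and
  \<open>\<Sum>\<^sub>k\<^sub>\<ge>\<^sub>1 \<phi>\<^sub>k(c)\<^sub>o\<^sub>o t\<^sup>k = \<Sum>\<^sub>m\<^sub>\<in>\<^sub>m\<^sub>s t\<^sup>m / (1 - t\<^sup>m) - \<Sum>\<^sub>m\<^sub>\<in>\<^sub>n\<^sub>s t\<^sup>m / (1 - t\<^sup>m)\<close>.
  The second formula says that \<open>\<phi>\<^sub>k(c)\<^sub>o\<^sub>o\<close> counts the \<open>m\<close> in \<open>ms\<close> dividing \<open>k\<close>, minus those in \<open>ns\<close>, and the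
  theorem follows by regrouping \<open>\<Prod>\<^sub>r \<Prod>\<^sub>m (1 - t\<^sup>m\<^sup>r)\<close> according to \<open>k = m r\<close>.
  For a cycle with \<open>N\<close> vertices, \<open>A t = (1 - t P) (1 - t P)\<^sup>T\<close> with a cyclic permutation matrix \<open>P\<close>, and
  \<open>ms = [N, N]\<close>, \<open>ns = []\<close>. The other diagrams are trees; rooted at \<open>o\<close>, leaf elimination writes
  \<open>A t\<close> as \<open>L diag(a) L\<^sup>T\<close>, so that the determinant is the product of the pivots \<open>a\<close> and the inverse has
  \<open>(o,o)\<close> entry \<open>1 / a\<^sub>o\<close>; here \<open>ms = [2p, 2q, 2r]\<close> and \<open>ns = [2]\<close>, where \<open>p, q, r\<close> are the arm lengths
  of the finite Dynkin diagram, the branch vertex included.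
\<close>

section \<open>Exchanging the order of an infinite product\<close>

lemma dvd_diff_mult:
  fixes d :: "'a::comm_ring_1"
  assumes "d dvd a - b" "d dvd a' - b'"
  shows "d dvd a * a' - b * b'"
proof -
  have "a * a' - b * b' = a * (a' - b') + (a - b) * b'" by (simp add: algebra_simps)
  then show ?thesis using assms by simp
qed

lemma dvd_diff_prod:
  fixes d :: "'a::comm_ring_1"
  assumes "\<And>x. x \<in> S \<Longrightarrow> d dvd F x - G x"
  shows "d dvd prod F S - prod G S"
  using assms by (induction S rule: infinite_finite_induct) (auto intro: dvd_diff_mult)

lemma dvd_diff_prod_list:
  fixes d :: "'a::comm_ring_1"
  assumes "\<And>x. x \<in> set xs \<Longrightarrow> d dvd F x - G x"
  shows "d dvd (\<Prod>x\<leftarrow>xs. F x) - (\<Prod>x\<leftarrow>xs. G x)"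
  using assms by (induction xs) (auto intro: dvd_diff_mult)

text \<open>The factors on both sides of the identity are known only as quotients w / u; this gives
  their congruence to 1 without inverting u.\<close>

lemma dvd_quotient_diff_one:
  fixes d :: "'a::comm_ring_1"
  assumes "z * u = w" "d dvd u - 1" "d dvd w - 1"
  shows "d dvd z - 1"
proof -
  have "z - 1 = (w - 1) - z * (u - 1)" using assms(1) by (simp add: algebra_simps)
  then show ?thesis using assms(2,3) by (metis dvd_diff dvd_mult)
qed

section \<open>Coefficients of infinite products\<close>

lemma fps_nth_eq_if_X_power_dvd:
  fixes F G :: "'a::comm_ring_1 fps"
  assumes "fps_X ^ N dvd F - G" "j < N"
  shows "fps_nth F j = fps_nth G j"
proof -
  from assms(1) obtain H where "F - G = fps_X ^ N * H" by (elim dvdE)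
  then have "fps_nth (F - G) j = 0" using assms(2) by (simp add: fps_X_power_mult_nth)
  then show ?thesis by simp
qed

text \<open>Factor r changes no coefficient of index at most r, so coefficient n of the partial
  products is constant from index n on, and the limit is read off on the diagonal.\<close>

lemma fps_has_prodI:
  fixes h :: "nat \<Rightarrow> 'a::comm_ring_1 fps"
  assumes h: "\<And>r. fps_X ^ Suc r dvd h r - 1"
  shows "h has_prod Abs_fps (\<lambda>n. fps_nth (\<Prod>r\<le>n. h r) n)"
proof -
  have stable: "fps_nth (\<Prod>r\<le>n. h r) j = fps_nth (\<Prod>r\<le>j. h r) j" if "j \<le> n" for n j
    using that
  proof (induction n rule: dec_induct)
    case (step n)
    have "fps_X ^ Suc (Suc n) dvd (\<Prod>r\<le>n. h r) * (h (Suc n) - 1)"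
      using h by (rule dvd_mult)
    then have "fps_X ^ Suc (Suc n) dvd (\<Prod>r\<le>Suc n. h r) - (\<Prod>r\<le>n. h r)"
      by (simp add: algebra_simps)
    from fps_nth_eq_if_X_power_dvd[OF this, of j]
    have "fps_nth (\<Prod>r\<le>Suc n. h r) j = fps_nth (\<Prod>r\<le>n. h r) j"
      using step by simp
    then show ?case using step by simp
  qed simp
  define P where "P = Abs_fps (\<lambda>n. fps_nth (\<Prod>r\<le>n. h r) n)"
  have "(\<lambda>n. \<Prod>r\<le>n. h r) \<longlonglongrightarrow> P"
    by (rule tendsto_fpsI) (auto simp: P_def eventually_sequentially intro: stable)
  \<comment> \<open>\<open>raw_has_prod\<close> requires a nonzero limit, which the constant
    coefficient guarantees.\<close>
  moreover have "fps_nth P 0 = 1"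
    using fps_nth_eq_if_X_power_dvd[OF h[of 0]] by (simp add: P_def)
  then have "P \<noteq> 0" by auto
  ultimately show ?thesis
    unfolding P_def[symmetric] has_prod_def raw_has_prod_def by simp
qed

text \<open>A negative \<open>powi\<close> is a power of \<open>inverse u\<close>, which inverts
  \<open>u\<close> because its constant coefficient is nonzero.\<close>

lemma fps_powi_diff:
  fixes u :: "'a::field fps"
  assumes "fps_nth u 0 \<noteq> 0"
  shows "u powi (int a - int b) * u ^ b = u ^ a"
proof (cases "b \<le> a")
  case True
  then have "u powi (int a - int b) = u ^ (a - b)" by (simp add: power_int_def nat_diff_distrib)
  then show ?thesis using True by (simp flip: power_add)
next
  case False
  then have "u powi (int a - int b) = inverse u ^ (b - a)"
    by (simp add: power_int_def nat_diff_distrib)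
  moreover have "u ^ b = u ^ (b - a) * u ^ a" using False by (simp flip: power_add)
  moreover have "inverse u ^ (b - a) * u ^ (b - a) = 1"
    using assms by (simp add: inverse_mult_eq_1 flip: power_mult_distrib)
  ultimately show ?thesis by (simp flip: mult.assoc)
qed

section \<open>Regrouping the double product by exponent\<close>

lemma fps_X_power_dvd_one_minus:
  assumes "N \<le> k"
  shows "(fps_X :: 'a::comm_ring_1 fps) ^ N dvd (1 - fps_X ^ k) - 1"
  using le_imp_power_dvd[OF assms, of fps_X] by simp

text \<open>Both sides multiply 1 - X^j over multiples j of m: the first n + 1 multiples on the
  left, those up to n + 1 on the right. The surplus on the left has exponents above n + 1, so it is
  1 modulo X^(n+1).\<close>

lemma euler_factor_cong:
  assumes "m > 0"
  shows "(fps_X :: 'a::comm_ring_1 fps) ^ Suc n dvd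
    (\<Prod>r\<le>n. 1 - fps_X ^ (m * Suc r)) - (\<Prod>k\<le>n. if m dvd Suc k then 1 - fps_X ^ Suc k else 1)"
proof -
  let ?g = "\<lambda>j. 1 - (fps_X :: 'a fps) ^ j"
  define J where "J = (\<lambda>r. m * Suc r) ` {..n}"
  define J' where "J' = {j \<in> {1..Suc n}. m dvd j}"
  have V: "(\<Prod>r\<le>n. ?g (m * Suc r)) = prod ?g J"
    unfolding J_def using assms by (subst prod.reindex) (auto simp: inj_on_def)
  have "(\<Prod>k\<le>n. if m dvd Suc k then ?g (Suc k) else 1) = (\<Prod>j\<in>Suc ` {..n}. if m dvd j then ?g j else 1)"
    by (subst prod.reindex) auto
  also have "Suc ` {..n} = {1..Suc n}" by (simp add: image_Suc_atMost)
  also have "(\<Prod>j\<in>{1..Suc n}. if m dvd j then ?g j else 1) = prod ?g J'"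
    unfolding J'_def by (rule prod.inter_filter[symmetric]) simp
  finally have W: "(\<Prod>k\<le>n. if m dvd Suc k then ?g (Suc k) else 1) = prod ?g J'" .
  have "J' \<subseteq> J"
  proof
    fix j assume j: "j \<in> J'"
    then obtain i where i: "j = m * i" by (auto simp: J'_def)
    with j obtain r where r: "i = Suc r" by (cases i) (auto simp: J'_def)
    have "r < j" using assms i r by (cases m) auto
    then show "j \<in> J" using j i r by (auto simp: J_def J'_def)
  qed
  then have split: "prod ?g J = prod ?g J' * prod ?g (J - J')"
    by (subst prod.subset_diff[of J' J]) (auto simp: J_def mult.commute)
  have "fps_X ^ Suc n dvd prod ?g (J - J') - prod (\<lambda>_. 1) (J - J')"
  proof (rule dvd_diff_prod)
    fix j assume "j \<in> J - J'"
    then have "Suc n \<le> j" using assms by (auto simp: J_def J'_def)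
    then show "(fps_X :: 'a fps) ^ Suc n dvd (1 - fps_X ^ j) - 1" by (rule fps_X_power_dvd_one_minus)
  qed
  then have "fps_X ^ Suc n dvd prod ?g J' * (prod ?g (J - J') - 1)" by simp
  then show ?thesis unfolding V W split by (simp add: algebra_simps)
qed

lemma prod_list_prod_swap:
  "(\<Prod>r\<in>S. \<Prod>m\<leftarrow>ms. F m r) = (\<Prod>m\<leftarrow>ms. \<Prod>r\<in>S. (F m r :: 'a::comm_monoid_mult))"
  by (induction ms) (auto simp: prod.distrib)

text \<open>Coefficient n of either infinite product is that of its n-th partial product. It
  therefore suffices to compare \<open>V\<close>, ordered by r, with \<open>W\<close>, ordered by
  the exponent k = m r, modulo X^(n+1), and to cancel the unit \<open>W ns n\<close>.\<close>

lemma has_prod_euler_exchange: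
  fixes D :: "nat \<Rightarrow> 'a::field fps"
  assumes pos: "\<And>m. m \<in> set ms \<Longrightarrow> m > 0" "\<And>m. m \<in> set ns \<Longrightarrow> m > 0"
    and D: "\<And>r. D r * (\<Prod>m\<leftarrow>ns. 1 - fps_X ^ (m * Suc r)) = (\<Prod>m\<leftarrow>ms. 1 - fps_X ^ (m * Suc r))"
    and e: "\<And>k. e k = int (length (filter (\<lambda>m. m dvd Suc k) ms)) - int (length (filter (\<lambda>m. m dvd Suc k) ns))"
  shows "\<exists>P. D has_prod P \<and> (\<lambda>k. (1 - fps_X ^ Suc k) powi e k) has_prod P"
proof -
  define R where "R k = (1 - fps_X ^ Suc k :: 'a fps) powi e k" for k
  define V where "V xs n = (\<Prod>m\<leftarrow>xs. \<Prod>r\<le>n. 1 - (fps_X :: 'a fps) ^ (m * Suc r))" for xs n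
  define W where "W xs n = (\<Prod>m\<leftarrow>xs. \<Prod>k\<le>n. if m dvd Suc k then 1 - (fps_X :: 'a fps) ^ Suc k else 1)" for xs n
  have filter_prod: "(\<Prod>m\<leftarrow>xs. if m dvd Suc k then u else 1) = u ^ length (filter (\<lambda>m. m dvd Suc k) xs)"
    for xs k and u :: "'a fps" by (induction xs) auto
  have R: "R k * (\<Prod>m\<leftarrow>ns. if m dvd Suc k then 1 - fps_X ^ Suc k else 1)
      = (\<Prod>m\<leftarrow>ms. if m dvd Suc k then 1 - fps_X ^ Suc k else 1)" for k
    unfolding R_def e filter_prod by (rule fps_powi_diff) simp
  have list_cong: "d dvd (\<Prod>m\<leftarrow>xs. F m) - 1" if "\<And>m. m \<in> set xs \<Longrightarrow> d dvd F m - 1"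
    for d :: "'a fps" and F :: "nat \<Rightarrow> 'a fps" and xs
    using dvd_diff_prod_list[of xs d F "\<lambda>_. 1"] that by (simp add: map_replicate_const)
  have D1: "fps_X ^ Suc r dvd D r - 1" for r
  proof (rule dvd_quotient_diff_one[OF D])
    have le: "Suc r \<le> m * Suc r" if "m > 0" for m using that by (cases m) auto
    show "fps_X ^ Suc r dvd (\<Prod>m\<leftarrow>ns. 1 - fps_X ^ (m * Suc r) :: 'a fps) - 1"
      by (rule list_cong, rule fps_X_power_dvd_one_minus, rule le, rule pos)
    show "fps_X ^ Suc r dvd (\<Prod>m\<leftarrow>ms. 1 - fps_X ^ (m * Suc r) :: 'a fps) - 1"
      by (rule list_cong, rule fps_X_power_dvd_one_minus, rule le, rule pos)
  qed
  have R1: "fps_X ^ Suc k dvd R k - 1" for k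
    by (rule dvd_quotient_diff_one[OF R]; rule list_cong) simp_all
  have "fps_nth (\<Prod>r\<le>n. D r) n = fps_nth (\<Prod>k\<le>n. R k) n" for n
  proof -
    have DV: "(\<Prod>r\<le>n. D r) * V ns n = V ms n"
      unfolding V_def prod_list_prod_swap[symmetric] D[symmetric] by (rule prod.distrib[symmetric])
    have RW: "(\<Prod>k\<le>n. R k) * W ns n = W ms n"
      unfolding W_def prod_list_prod_swap[symmetric] R[symmetric] by (rule prod.distrib[symmetric])
    have VW: "fps_X ^ Suc n dvd V xs n - W xs n" if "\<And>m. m \<in> set xs \<Longrightarrow> m > 0" for xs
      unfolding V_def W_def by (intro dvd_diff_prod_list euler_factor_cong that)
    have "fps_nth (W ns n) 0 = 1"
    proof -
      have "fps_nth (prod F S) 0 = (\<Prod>x\<in>S. fps_nth (F x) 0)" for F :: "nat \<Rightarrow> 'a fps" and S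
        by (induction S rule: infinite_finite_induct) auto
      then show ?thesis unfolding W_def by (induction ns) (auto intro!: prod.neutral)
    qed
    then have unit: "is_unit (W ns n)" by simp
    have "((\<Prod>r\<le>n. D r) - (\<Prod>k\<le>n. R k)) * W ns n
        = (V ms n - W ms n) - (\<Prod>r\<le>n. D r) * (V ns n - W ns n)"
      unfolding DV[symmetric] RW[symmetric] by (simp add: algebra_simps)
    also have "fps_X ^ Suc n dvd \<dots>" by (rule dvd_diff[OF VW dvd_mult[OF VW]]) (fact pos)+
    finally have "fps_X ^ Suc n dvd (\<Prod>r\<le>n. D r) - (\<Prod>k\<le>n. R k)"
      using unit by (simp add: dvd_mult_unit_iff)
    then show ?thesis by (rule fps_nth_eq_if_X_power_dvd) simp
  qed
  then show ?thesis
    using fps_has_prodI[of D, OF D1] fps_has_prodI[of R, OF R1] unfolding R_def by auto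
qed

section \<open>Determinants\<close>

text \<open>If a permutation p contributes, then h i <= h (p i) for all i, strictly where p moves i;
  summing over i forces p to be the identity. The rank h may repeat values, so depth in a tree is
  admissible.\<close>

lemma det_triangular_rank:
  fixes A :: "'a::comm_ring_1 ^ 'n ^ 'n" and h :: "'n \<Rightarrow> nat"
  assumes "\<And>i j. i \<noteq> j \<Longrightarrow> \<not> h i < h j \<Longrightarrow> A $ i $ j = 0"
  shows "det A = (\<Prod>i\<in>UNIV. A $ i $ i)"
proof -
  have zero: "(\<Prod>i\<in>UNIV. A $ i $ p i) = 0" if p: "p permutes UNIV" and "p \<noteq> id" for p
  proof (rule ccontr)
    assume "(\<Prod>i\<in>UNIV. A $ i $ p i) \<noteq> 0"
    then have nz: "A $ i $ p i \<noteq> 0" for i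
      by (metis UNIV_I finite prod_zero)
    from \<open>p \<noteq> id\<close> obtain k where k: "p k \<noteq> k" by (auto simp: fun_eq_iff)
    have lt: "h i < h (p i)" if "p i \<noteq> i" for i
      using assms[of i "p i"] nz[of i] that by metis
    have "(\<Sum>i\<in>UNIV. h i) < (\<Sum>i\<in>UNIV. h (p i))"
    proof (rule sum_strict_mono_ex1)
      show "\<forall>i\<in>UNIV. h i \<le> h (p i)" using lt by (metis less_imp_le order_refl)
      show "\<exists>i\<in>UNIV. h i < h (p i)" using lt k by blast
    qed simp
    also have "(\<Sum>i\<in>UNIV. h (p i)) = (\<Sum>i\<in>UNIV. h i)"
      using sum.permute[OF p, of h] by (simp add: o_def)
    finally show False by simp
  qed
  have "det A = (\<Sum>p\<in>{id}. of_int (sign p) * (\<Prod>i\<in>UNIV. A $ i $ p i))"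
    unfolding det_def
    by (rule sum.mono_neutral_right) (auto simp: permutes_id zero finite_permutations)
  then show ?thesis by (simp add: sign_id)
qed

text \<open>For the embedding \<open>fps_to_fls\<close>, which carries determinants of power series
  into the field of Laurent series.\<close>

lemma det_map_hom:
  fixes A :: "'a::comm_ring_1 ^ 'n ^ 'n" and h :: "'a \<Rightarrow> 'b::comm_ring_1"
  assumes add: "\<And>x y. h (x + y) = h x + h y" and mult: "\<And>x y. h (x * y) = h x * h y" and one: "h 1 = 1"
  shows "det (\<chi> i j. h (A $ i $ j)) = h (det A)"
proof -
  have zero: "h 0 = 0" using add[of 0 0] by simp
  have minus: "h (- x) = - h x" for x
    using add[of x "- x"] zero by (simp add: eq_neg_iff_add_eq_0 add.commute)
  have sum: "h (sum g S) = (\<Sum>x\<in>S. h (g x))" if "finite S" for S and g :: "'c \<Rightarrow> 'a"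
    using that by (induction S) (auto simp: zero add)
  have prod: "h (prod g S) = (\<Prod>x\<in>S. h (g x))" if "finite S" for S and g :: "'c \<Rightarrow> 'a"
    using that by (induction S) (auto simp: one mult)
  have sgn: "h (of_int (sign p)) = of_int (sign p)" for p :: "'n \<Rightarrow> 'n"
    by (auto simp: sign_def one minus)
  show ?thesis
    unfolding det_def by (simp add: sum prod mult sgn finite_permutations)
qed

section \<open>Chebyshev matrices of cycles and trees\<close>

definition chebyshev_matrix :: "'a::comm_ring_1 \<Rightarrow> 'a ^ 'n ^ 'n \<Rightarrow> 'a ^ 'n ^ 'n" where
  "chebyshev_matrix t C = mat 1 - scale_matrix t C + scale_matrix (t ^ 2) (mat 1)"

text \<open>Each x in S stands for one edge from x to \<open>\<sigma> x\<close>: to the parent in a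
  tree, to the successor in a cycle. The two terms add up to 2 for a loop and for the double edge of
  the 2-cycle, as in the double quiver.\<close>

definition graph_matrix :: "nat set \<Rightarrow> (nat \<Rightarrow> nat) \<Rightarrow> ('n \<Rightarrow> nat) \<Rightarrow> 'a::semiring_1 ^ 'n ^ 'n" where
  "graph_matrix S \<sigma> f =
     (\<chi> i j. of_bool (f i \<in> S \<and> f j = \<sigma> (f i)) + of_bool (f j \<in> S \<and> f i = \<sigma> (f j)))"

lemma chebyshev_graph_matrix_nth:
  "chebyshev_matrix t (graph_matrix S \<sigma> f) $ i $ j =
     of_bool (i = j) * (1 + t ^ 2)
     - t * (of_bool (f i \<in> S \<and> f j = \<sigma> (f i)) + of_bool (f j \<in> S \<and> f i = \<sigma> (f j)))"
  by (simp add: chebyshev_matrix_def graph_matrix_def scale_matrix_def mat_def)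

text \<open>Column y of \<open>L\<close> has -t / a y at the parent of y, and \<open>B\<close> is L
  diag(a); both are triangular with respect to d. The root column of \<open>L\<close> is a unit
  vector, so solving B (L^T w) = \<kappa> e_v gives L^T w = (\<kappa> / a 0) e_v, whose entry at v
  is w_v.\<close>

lemma tree_factorization:
  fixes f :: "'n::finite \<Rightarrow> nat" and t :: "'a::field" and a :: "nat \<Rightarrow> 'a"
  assumes f: "bij_betw f UNIV {0..n}"
    and par: "\<And>m. m \<in> {1..n} \<Longrightarrow> d (\<sigma> m) < (d m :: nat)"
    and nz: "\<And>m. m \<in> {0..n} \<Longrightarrow> a m \<noteq> 0"
    and a: "\<And>m. m \<in> {0..n} \<Longrightarrow> a m + (\<Sum>u \<in> {u \<in> {1..n}. \<sigma> u = m}. t ^ 2 / a u) = 1 + t ^ 2"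
  defines "A \<equiv> chebyshev_matrix t (graph_matrix {1..n} \<sigma> f)"
  shows "det A = (\<Prod>m\<in>{0..n}. a m)"
    and "f v = 0 \<Longrightarrow> A *v w = axis v \<kappa> \<Longrightarrow> a 0 * w $ v = \<kappa>"
proof -
  have f_in: "f i \<in> {0..n}" for i using f by (auto simp: bij_betw_def)
  have f_inj: "f i = f j \<longleftrightarrow> i = j" for i j using f by (auto simp: bij_betw_def inj_def)
  have sum_f: "(\<Sum>i\<in>UNIV. F (f i)) = (\<Sum>m\<in>{0..n}. F m)" for F :: "nat \<Rightarrow> 'a"
    using f by (rule sum.reindex_bij_betw)
  define l where "l x y = of_bool (x = y) - of_bool (y \<in> {1..n} \<and> x = \<sigma> y) * (t / a y)" for x y
  define L :: "'a ^ 'n ^ 'n" where "L = (\<chi> i j. l (f i) (f j))"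
  define B :: "'a ^ 'n ^ 'n" where "B = (\<chi> i j. l (f i) (f j) * a (f j))"
  have l_off: "l x y = 0" if "x \<noteq> y" "\<not> d x < d y" for x y
    using that par by (auto simp: l_def)
  have l_diag: "l x x = 1" for x
    using par[of x] by (auto simp: l_def)
  have det_L: "det L = 1"
    by (subst det_triangular_rank[where h = "d \<circ> f"]) (auto simp: L_def l_off l_diag f_inj)
  have det_B: "det B = (\<Prod>m\<in>{0..n}. a m)"
    by (subst det_triangular_rank[where h = "d \<circ> f"])
       (auto simp: B_def l_off l_diag f_inj prod.reindex_bij_betw[OF f])
  \<comment> \<open>A product of two parent terms survives only for x = y because each vertex has a
    single parent: elimination creates no new off-diagonal entries, and the diagonal is the pivot
    equation.\<close>
  have entry: "(\<Sum>m\<in>{0..n}. l x m * a m * l y m) =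
     of_bool (x = y) * (1 + t ^ 2)
     - t * (of_bool (x \<in> {1..n} \<and> y = \<sigma> x) + of_bool (y \<in> {1..n} \<and> x = \<sigma> y))"
    if x: "x \<in> {0..n}" and y: "y \<in> {0..n}" for x y
  proof -
    have "(\<Sum>m\<in>{0..n}. l x m * a m * l y m) =
       (\<Sum>m\<in>{0..n}. (if x = m then of_bool (x = y) * a m else 0)
          - (if x = m then of_bool (m \<in> {1..n} \<and> y = \<sigma> m) * t else 0)
          - (if y = m then of_bool (m \<in> {1..n} \<and> x = \<sigma> m) * t else 0)
          + (if m \<in> {1..n} \<and> \<sigma> m = x then of_bool (x = y) * (t ^ 2 / a m) else 0))"
    proof (rule sum.cong)
      fix m assume "m \<in> {0..n}"
      have "(p - r * (t / c)) * c * (p' - r' * (t / c)) = p * p' * c - p * r' * t - r * p' * t + r * r' * (t ^ 2 / c)"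
        if "c \<noteq> 0" for p r p' r' c :: 'a
        using that by (simp add: divide_simps) (simp add: algebra_simps power2_eq_square)
      from this[OF nz[OF \<open>m \<in> {0..n}\<close>]] show "l x m * a m * l y m =
          (if x = m then of_bool (x = y) * a m else 0)
          - (if x = m then of_bool (m \<in> {1..n} \<and> y = \<sigma> m) * t else 0)
          - (if y = m then of_bool (m \<in> {1..n} \<and> x = \<sigma> m) * t else 0)
          + (if m \<in> {1..n} \<and> \<sigma> m = x then of_bool (x = y) * (t ^ 2 / a m) else 0)"
        unfolding l_def by (auto simp: of_bool_def)
    qed simp
    also have "\<dots> = of_bool (x = y) * a x - of_bool (x \<in> {1..n} \<and> y = \<sigma> x) * t
        - of_bool (y \<in> {1..n} \<and> x = \<sigma> y) * t
        + (\<Sum>m\<in>{0..n}. if m \<in> {1..n} \<and> \<sigma> m = x then of_bool (x = y) * (t ^ 2 / a m) else 0)"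
      using x y by (simp add: sum.distrib sum_subtractf)
    also have "(\<Sum>m\<in>{0..n}. if m \<in> {1..n} \<and> \<sigma> m = x then of_bool (x = y) * (t ^ 2 / a m) else 0)
        = of_bool (x = y) * (\<Sum>u \<in> {u \<in> {1..n}. \<sigma> u = x}. t ^ 2 / a u)"
      unfolding sum_distrib_left
      by (rule sum.mono_neutral_cong_right) auto
    finally show ?thesis
      using a[OF x] by (auto simp: algebra_simps)
  qed
  have "A $ i $ j = (\<Sum>m\<in>{0..n}. l (f i) m * a m * l (f j) m)" for i j
    unfolding A_def chebyshev_graph_matrix_nth f_inj[symmetric] by (rule entry[OF f_in f_in, symmetric])
  moreover have "(B ** transpose L) $ i $ j = (\<Sum>m\<in>{0..n}. l (f i) m * a m * l (f j) m)" for i j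
    unfolding B_def L_def matrix_matrix_mult_def transpose_def vec_lambda_beta by (rule sum_f)
  ultimately have A_eq: "A = B ** transpose L"
    by (simp add: vec_eq_iff)
  show "det A = (\<Prod>m\<in>{0..n}. a m)"
    by (simp add: A_eq det_mul det_L det_B)
  show "a 0 * w $ v = \<kappa>" if v: "f v = 0" and w: "A *v w = axis v \<kappa>"
  proof -
    have l0: "l x 0 = of_bool (x = 0)" for x by (simp add: l_def)
    have "inj ((*v) B)"
      using det_B nz by (intro inj_matrix_vector_mult) (simp add: invertible_det_nz prod_zero_iff)
    moreover have "B *v (transpose L *v w) = B *v axis v (\<kappa> / a 0)"
    proof -
      have "B *v axis v (\<kappa> / a 0) = axis v \<kappa>"
        using nz[of 0] f_inj[of _ v]
        by (auto simp: vec_eq_iff matrix_vector_mult_def axis_def B_def v l0 if_distrib cong: if_cong)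
      then show ?thesis using w unfolding A_eq matrix_vector_mul_assoc by metis
    qed
    ultimately have "transpose L *v w = axis v (\<kappa> / a 0)" by (simp add: inj_def)
    then have "(transpose L *v w) $ v = \<kappa> / a 0" by (simp add: axis_def)
    moreover have "(transpose L *v w) $ v = w $ v"
      using f_inj[of _ v]
      by (simp add: matrix_vector_mult_def transpose_def L_def v l0 if_distrib if_distribR of_bool_def cong: if_cong)
    ultimately show ?thesis using nz[of 0] by (simp add: field_simps)
  qed
qed

text \<open>\<open>M\<close> is 1 - tP, and \<open>U\<close> inverts 1 - tN, where N is P without
  the edge from n back to 0. Hence \<open>M ** U\<close> differs from the identity only in the row
  of n, is lower triangular, and shows det M = 1 - t^(n+1).\<close>

lemma cycle_determinant:
  fixes f :: "'n::finite \<Rightarrow> nat" and t :: "'a::comm_ring_1"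
  assumes f: "bij_betw f UNIV {0..n}"
  defines "\<sigma> \<equiv> \<lambda>m. Suc m mod Suc n"
  shows "det (chebyshev_matrix t (graph_matrix {0..n} \<sigma> f)) = (1 - t ^ Suc n) ^ 2"
proof -
  have f_in: "f i \<in> {0..n}" for i using f by (auto simp: bij_betw_def)
  have f_inj: "f i = f j \<longleftrightarrow> i = j" for i j using f by (auto simp: bij_betw_def inj_def)
  have sum_f: "(\<Sum>i\<in>UNIV. F (f i)) = (\<Sum>m\<in>{0..n}. F m)" for F :: "nat \<Rightarrow> 'a"
    using f by (rule sum.reindex_bij_betw)
  have \<sigma>_in: "\<sigma> m \<in> {0..n}" for m by (auto simp: \<sigma>_def less_Suc_eq_le[symmetric])
  have \<sigma>_inj: "\<sigma> x = \<sigma> y \<longleftrightarrow> x = y" if "x \<in> {0..n}" "y \<in> {0..n}" for x y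
    using that by (auto simp: \<sigma>_def mod_Suc split: if_splits)
  define M :: "'a ^ 'n ^ 'n" where
    "M = (\<chi> i j. of_bool (f i = f j) - t * of_bool (f j = \<sigma> (f i)))"
  define u where "u x y = (if x \<le> y then t ^ (y - x) else 0)" for x y :: nat
  define U :: "'a ^ 'n ^ 'n" where "U = (\<chi> i j. u (f i) (f j))"
  have det_U: "det U = 1"
    by (subst det_triangular_rank[where h = f]) (auto simp: U_def u_def f_inj dest: le_neq_implies_less)
  have M_sum: "(\<Sum>k\<in>UNIV. M $ i $ k * F (f k)) = F (f i) - t * F (\<sigma> (f i))" for i and F :: "nat \<Rightarrow> 'a"
  proof -
    have "(\<Sum>k\<in>UNIV. M $ i $ k * F (f k))
        = (\<Sum>m\<in>{0..n}. (of_bool (f i = m) - t * of_bool (m = \<sigma> (f i))) * F m)"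
      unfolding M_def vec_lambda_beta by (rule sum_f)
    also have "\<dots> = (\<Sum>m\<in>{0..n}. (if f i = m then F m else 0) - (if m = \<sigma> (f i) then t * F m else 0))"
      by (rule sum.cong) (auto simp: algebra_simps)
    finally show ?thesis using f_in[of i] \<sigma>_in by (simp add: sum_subtractf)
  qed
  have MU: "(M ** U) $ i $ j = u (f i) (f j) - t * u (\<sigma> (f i)) (f j)" for i j
    using M_sum[of i "\<lambda>m. u m (f j)"] by (simp add: matrix_matrix_mult_def U_def)
  have step: "u x y - t * u (\<sigma> x) y = of_bool (x = y) - of_bool (x = n) * t ^ Suc y"
    if "x \<in> {0..n}" "y \<in> {0..n}" for x y
  proof (cases "x = n")
    case True
    then show ?thesis using that by (auto simp: u_def \<sigma>_def)
  next
    case False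
    then have "\<sigma> x = Suc x" using that by (auto simp: \<sigma>_def)
    then show ?thesis using False that
      by (auto simp: u_def not_less_eq_eq Suc_diff_Suc simp flip: power_Suc)
  qed
  have "det (M ** U) = (\<Prod>i\<in>UNIV. (M ** U) $ i $ i)"
  proof (rule det_triangular_rank[where h = "\<lambda>i. n - f i"])
    fix i j :: 'n assume "i \<noteq> j" "\<not> n - f i < n - f j"
    then show "(M ** U) $ i $ j = 0"
      using f_in[of i] f_in[of j] f_inj[of i j] by (auto simp: MU step[OF f_in f_in])
  qed
  also have "\<dots> = (\<Prod>m\<in>{0..n}. 1 - of_bool (m = n) * t ^ Suc m)"
    using prod.reindex_bij_betw[OF f, of "\<lambda>m. 1 - of_bool (m = n) * t ^ Suc m"]
    by (simp add: MU step[OF f_in f_in])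
  also have "\<dots> = (\<Prod>m\<in>{0..n}. if m = n then 1 - t ^ Suc m else 1)"
    by (rule prod.cong) auto
  also have "\<dots> = 1 - t ^ Suc n" by simp
  finally have det_M: "det M = 1 - t ^ Suc n" by (simp add: det_mul det_U)
  have "(M ** transpose M) $ i $ j = chebyshev_matrix t (graph_matrix {0..n} \<sigma> f) $ i $ j" for i j
  proof -
    have "(M ** transpose M) $ i $ j
        = (\<Sum>k\<in>UNIV. M $ i $ k * (of_bool (f j = f k) - t * of_bool (f k = \<sigma> (f j))))"
      by (simp add: matrix_matrix_mult_def transpose_def M_def)
    also have "\<dots> = (of_bool (f j = f i) - t * of_bool (f i = \<sigma> (f j)))
        - t * (of_bool (f j = \<sigma> (f i)) - t * of_bool (\<sigma> (f i) = \<sigma> (f j)))"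
      by (rule M_sum)
    finally show ?thesis
      using f_in \<sigma>_inj[of "f i" "f j"]
      by (auto simp: chebyshev_graph_matrix_nth f_inj algebra_simps power2_eq_square)
  qed
  then have "chebyshev_matrix t (graph_matrix {0..n} \<sigma> f) = M ** transpose M"
    by (simp add: vec_eq_iff)
  then show ?thesis by (simp add: det_mul det_M power2_eq_square)
qed

text \<open>With N = n + 1, the vector x_m = t^m + t^(N-m) satisfies t (x_(m-1) + x_(m+1)) = (1 +
  t^2) x_m away from 0, and x_N = x_0. So the row vector x A is a multiple of e_v, and pairing x
  with A w isolates w_v.\<close>

lemma cycle_resolvent:
  fixes f :: "'n::finite \<Rightarrow> nat" and t :: "'a::idom"
  assumes f: "bij_betw f UNIV {0..n}" and t: "t ^ 2 \<noteq> 1"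
  defines "\<sigma> \<equiv> \<lambda>m. Suc m mod Suc n"
  assumes v: "f v = 0"
    and w: "chebyshev_matrix t (graph_matrix {0..n} \<sigma> f) *v w = axis v (1 - t ^ 2)"
  shows "(1 - t ^ Suc n) * w $ v = 1 + t ^ Suc n"
proof -
  have f_in: "f i \<in> {0..n}" for i using f by (auto simp: bij_betw_def)
  have f_inj: "f i = f j \<longleftrightarrow> i = j" for i j using f by (auto simp: bij_betw_def inj_def)
  have sum_f: "(\<Sum>i\<in>UNIV. F (f i)) = (\<Sum>m\<in>{0..n}. F m)" for F :: "nat \<Rightarrow> 'a"
    using f by (rule sum.reindex_bij_betw)
  define A :: "'a ^ 'n ^ 'n" where "A = chebyshev_matrix t (graph_matrix {0..n} \<sigma> f)"
  define x where "x m = t ^ m + t ^ (Suc n - m)" for m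
  define \<rho> where "\<rho> m = (if m = 0 then n else m - 1)" for m :: nat
  have \<rho>: "m \<in> {0..n} \<and> y = \<sigma> m \<longleftrightarrow> m = \<rho> y" if "y \<in> {0..n}" for m y
    using that by (auto simp: \<sigma>_def \<rho>_def mod_Suc split: if_splits)
  have \<sigma>_in: "\<sigma> m \<in> {0..n}" for m by (auto simp: \<sigma>_def less_Suc_eq_le[symmetric])
  have \<rho>_in: "\<rho> m \<in> {0..n}" if "m \<in> {0..n}" for m using that by (auto simp: \<rho>_def)
  have col: "(\<Sum>i\<in>UNIV. x (f i) * A $ i $ j) = of_bool (j = v) * ((1 - t ^ 2) * (1 - t ^ Suc n))" for j
  proof -
    have fj: "f j \<in> {0..n}" by (rule f_in)
    have "(\<Sum>i\<in>UNIV. x (f i) * A $ i $ j) = (\<Sum>m\<in>{0..n}. x m * (of_bool (m = f j) * (1 + t ^ 2)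
        - t * (of_bool (m \<in> {0..n} \<and> f j = \<sigma> m) + of_bool (f j \<in> {0..n} \<and> m = \<sigma> (f j)))))"
      unfolding A_def chebyshev_graph_matrix_nth f_inj[symmetric] by (rule sum_f)
    also have "\<dots> = (\<Sum>m\<in>{0..n}. (if m = f j then x m * (1 + t ^ 2) else 0)
        - (if m = \<rho> (f j) then t * x m else 0) - (if m = \<sigma> (f j) then t * x m else 0))"
      unfolding \<rho>[OF fj] using fj by (intro sum.cong) (auto simp: algebra_simps)
    also have "\<dots> = x (f j) * (1 + t ^ 2) - t * x (\<rho> (f j)) - t * x (\<sigma> (f j))"
      using fj \<sigma>_in \<rho>_in by (simp add: sum_subtractf)
    also have "\<dots> = of_bool (f j = 0) * ((1 - t ^ 2) * (1 - t ^ Suc n))"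
    proof (cases "f j = 0")
      case True
      then show ?thesis
        by (cases n) (auto simp: x_def \<rho>_def \<sigma>_def algebra_simps power2_eq_square)
    next
      case False
      then obtain m where m: "f j = Suc m" by (cases "f j") auto
      define k where "k = n - Suc m"
      then have n: "n = Suc (m + k)" using fj m by auto
      show ?thesis
      proof (cases k)
        \<comment> \<open>Here f j = n, whose successor wraps around to 0.\<close>
        case 0
        then have 1: "Suc n - Suc m = Suc 0" "Suc n - m = Suc (Suc 0)" "Suc n - 0 = Suc (Suc m)"
          "\<sigma> (Suc m) = 0" "\<rho> (Suc m) = m"
          using n by (auto simp: \<sigma>_def \<rho>_def)
        show ?thesis unfolding m x_def 1 by (simp add: algebra_simps power2_eq_square)
      next
        case (Suc k')
        have 1: "Suc n - Suc m = Suc (Suc k')" "Suc n - m = Suc (Suc (Suc k'))"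
          "Suc n - Suc (Suc m) = Suc k'" "\<sigma> (Suc m) = Suc (Suc m)" "\<rho> (Suc m) = m"
          using n Suc by (auto simp: \<sigma>_def \<rho>_def)
        show ?thesis unfolding m x_def 1 by (simp add: algebra_simps power2_eq_square)
      qed
    qed
    finally show ?thesis using f_inj[of j v] v by simp
  qed
  have "(\<Sum>j\<in>UNIV. (\<Sum>i\<in>UNIV. x (f i) * A $ i $ j) * w $ j)
      = (\<Sum>j\<in>UNIV. if j = v then (1 - t ^ 2) * (1 - t ^ Suc n) * w $ j else 0)"
    unfolding col by (rule sum.cong) auto
  then have "(\<Sum>j\<in>UNIV. (\<Sum>i\<in>UNIV. x (f i) * A $ i $ j) * w $ j) = (1 - t ^ 2) * (1 - t ^ Suc n) * w $ v"
    by simp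
  moreover have "(\<Sum>j\<in>UNIV. (\<Sum>i\<in>UNIV. x (f i) * A $ i $ j) * w $ j)
      = (\<Sum>i\<in>UNIV. x (f i) * (A *v w) $ i)"
    unfolding matrix_vector_mult_def vec_lambda_beta sum_distrib_left sum_distrib_right
    by (subst sum.swap) (simp add: mult.assoc)
  moreover have "\<dots> = (1 + t ^ Suc n) * (1 - t ^ 2)"
    using v w by (simp add: A_def axis_def x_def if_distrib cong: if_cong)
  ultimately have "(1 - t ^ 2) * ((1 - t ^ Suc n) * w $ v) = (1 - t ^ 2) * (1 + t ^ Suc n)"
    by (simp add: mult_ac)
  then show ?thesis using t by simp
qed

text \<open>
  For \<open>w = \<Sum>\<^sub>k\<^sub>\<ge>\<^sub>0 \<phi>\<^sub>k(C) e\<^sub>v t\<^sup>k - e\<^sub>v\<close>, the last conjunct computes the generating function of \<open>\<phi>\<^sub>k(C)\<^sub>v\<^sub>v\<close>.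
\<close>

definition euler_type :: "nat list \<Rightarrow> nat list \<Rightarrow> 'n::finite \<Rightarrow> 'a::field ^ 'n ^ 'n \<Rightarrow> bool" where
  "euler_type ms ns v C \<longleftrightarrow> (\<forall>t. (\<forall>m>0. t ^ m \<noteq> 1) \<longrightarrow>
     det (chebyshev_matrix t C) * (\<Prod>m\<leftarrow>ns. 1 - t ^ m) = (\<Prod>m\<leftarrow>ms. 1 - t ^ m) \<and>
     (\<forall>w. chebyshev_matrix t C *v w = axis v (1 - t ^ 2) \<longrightarrow>
        w $ v = 1 + (\<Sum>m\<leftarrow>ms. t ^ m / (1 - t ^ m)) - (\<Sum>m\<leftarrow>ns. t ^ m / (1 - t ^ m))))"

lemma euler_type_cycle:
  fixes f :: "'n::finite \<Rightarrow> nat"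
  assumes "bij_betw f UNIV {0..n}" "f v = 0"
  shows "euler_type [Suc n, Suc n] [] v (graph_matrix {0..n} (\<lambda>m. Suc m mod Suc n) f :: 'a::field ^ 'n ^ 'n)"
  unfolding euler_type_def
proof (intro allI impI conjI)
  fix t :: 'a assume t: "\<forall>m>0. t ^ m \<noteq> 1"
  show "det (chebyshev_matrix t (graph_matrix {0..n} (\<lambda>m. Suc m mod Suc n) f)) * (\<Prod>m\<leftarrow>[]. 1 - t ^ m)
      = (\<Prod>m\<leftarrow>[Suc n, Suc n]. 1 - t ^ m)"
    unfolding cycle_determinant[OF assms(1)] by (simp add: power2_eq_square)
  fix w assume "chebyshev_matrix t (graph_matrix {0..n} (\<lambda>m. Suc m mod Suc n) f) *v w = axis v (1 - t ^ 2)"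
  then have *: "(1 - t ^ Suc n) * w $ v = 1 + t ^ Suc n"
    by (intro cycle_resolvent[OF assms(1) _ assms(2)]) (use t in auto)
  \<comment> \<open>(1 + T) / (1 - T) = 1 + 2 T / (1 - T); the 2 is the repeated list entry.\<close>
  define T where "T = t ^ Suc n"
  have "1 - T \<noteq> 0" using t unfolding T_def by (metis eq_iff_diff_eq_0 zero_less_Suc)
  moreover from this have "w $ v = (1 + T) / (1 - T)"
    using * by (simp add: T_def nonzero_eq_divide_eq mult.commute del: power_Suc)
  ultimately show "w $ v = 1 + (\<Sum>m\<leftarrow>[Suc n, Suc n]. t ^ m / (1 - t ^ m)) - (\<Sum>m\<leftarrow>[]. t ^ m / (1 - t ^ m))"
    unfolding T_def[symmetric] list.map sum_list.Cons sum_list.Nil by (simp add: divide_simps)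
qed

text \<open>
  The values of \<open>a\<close> are the pivots of leaf elimination towards the root \<open>0\<close>, where \<open>\<sigma>\<close> is the parent function
  and \<open>q = t\<^sup>2\<close>.
\<close>

definition tree_pivots ::
    "nat \<Rightarrow> (nat \<Rightarrow> nat) \<Rightarrow> nat list \<Rightarrow> nat list \<Rightarrow> 'a::field \<Rightarrow> (nat \<Rightarrow> 'a) \<Rightarrow> bool" where
  "tree_pivots n \<sigma> ms ns q a \<longleftrightarrow>
     (\<forall>m\<in>{0..n}. a m \<noteq> 0 \<and> a m + (\<Sum>u \<in> {u \<in> {1..n}. \<sigma> u = m}. q / a u) = 1 + q) \<and>
     (\<Prod>m\<in>{0..n}. a m) * (\<Prod>m\<leftarrow>ns. 1 - q ^ m) = (\<Prod>m\<leftarrow>ms. 1 - q ^ m) \<and>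
     a 0 * (1 + (\<Sum>m\<leftarrow>ms. q ^ m / (1 - q ^ m)) - (\<Sum>m\<leftarrow>ns. q ^ m / (1 - q ^ m))) = 1 - q"

text \<open>The pivots depend on t only through q = t^2, so they are found in terms of q, and the
  list entries are doubled on return to t.\<close>

lemma euler_type_tree:
  fixes f :: "'n::finite \<Rightarrow> nat"
  assumes f: "bij_betw f UNIV {0..n}" "f v = 0"
    and par: "\<And>m. m \<in> {1..n} \<Longrightarrow> d (\<sigma> m) < (d m :: nat)"
    and pivots: "\<And>q :: 'a::field. \<forall>m>0. q ^ m \<noteq> 1 \<Longrightarrow> \<exists>a. tree_pivots n \<sigma> ms ns q a"
  shows "euler_type (map ((*) 2) ms) (map ((*) 2) ns) v (graph_matrix {1..n} \<sigma> f :: 'a ^ 'n ^ 'n)"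
  unfolding euler_type_def
proof (rule allI, rule impI)
  fix t :: 'a assume t: "\<forall>m>0. t ^ m \<noteq> 1"
  define q where "q = t ^ 2"
  have "\<forall>m>0. q ^ m \<noteq> 1" using t by (simp add: q_def flip: power_mult)
  from pivots[OF this] obtain a where a: "tree_pivots n \<sigma> ms ns q a" ..
  have pow: "t ^ (2 * m) = q ^ m" for m by (simp add: q_def power_mult)
  note tree = tree_factorization[where d = d and \<sigma> = \<sigma> and a = a and t = t, OF f(1) par, folded q_def]
  have det: "det (chebyshev_matrix t (graph_matrix {1..n} \<sigma> f)) = (\<Prod>m\<in>{0..n}. a m)"
    by (rule tree(1)) (use a in \<open>auto simp: tree_pivots_def\<close>)
  have w: "w $ v = 1 + (\<Sum>m\<leftarrow>ms. q ^ m / (1 - q ^ m)) - (\<Sum>m\<leftarrow>ns. q ^ m / (1 - q ^ m))"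
    if "chebyshev_matrix t (graph_matrix {1..n} \<sigma> f) *v w = axis v (1 - q)" for w
  proof -
    have "a 0 * w $ v = 1 - q"
      by (rule tree(2)[OF _ _ _ f(2) that]) (use a in \<open>auto simp: tree_pivots_def\<close>)
    moreover have "a 0 \<noteq> 0" using a by (simp add: tree_pivots_def)
    ultimately show ?thesis using a unfolding tree_pivots_def by (metis mult_left_cancel)
  qed
  show "det (chebyshev_matrix t (graph_matrix {1..n} \<sigma> f)) * (\<Prod>m\<leftarrow>map ((*) 2) ns. 1 - t ^ m)
      = (\<Prod>m\<leftarrow>map ((*) 2) ms. 1 - t ^ m) \<and>
     (\<forall>w. chebyshev_matrix t (graph_matrix {1..n} \<sigma> f) *v w = axis v (1 - t ^ 2) \<longrightarrow>
        w $ v = 1 + (\<Sum>m\<leftarrow>map ((*) 2) ms. t ^ m / (1 - t ^ m))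
          - (\<Sum>m\<leftarrow>map ((*) 2) ns. t ^ m / (1 - t ^ m)))"
    unfolding det list.map_comp o_def pow q_def[symmetric]
    using a w unfolding tree_pivots_def by blast
qed

text \<open>1 + q^m divides 1 - q^(2m). Denominators below are proved nonzero by exhibiting a
  multiple of this form.\<close>

lemma power_plus_one_neq_0:
  fixes q :: "'a::comm_ring_1"
  assumes "\<forall>m>0. q ^ m \<noteq> 1" "m > 0"
  shows "1 + q ^ m \<noteq> 0"
proof
  assume *: "1 + q ^ m = 0"
  have "1 - q ^ (m * 2) = (1 + q ^ m) * (1 - q ^ m)"
    by (simp add: power_mult power2_eq_square algebra_simps)
  then have "q ^ (m * 2) = 1" by (simp add: *)
  then show False using assms by auto
qed

section \<open>The pivots of the extended diagrams of types D and E\<close>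

text \<open>All edges point towards 0; the edge from 1 to 2 is the only one whose parent has the
  larger label.\<close>

definition D_parent :: "nat \<Rightarrow> nat \<Rightarrow> nat" where
  "D_parent n m = (if m = 1 then 2 else if m = 2 then 0 else if m = n then n - 2 else m - 1)"

text \<open>With \<open>s m\<close> = 1 + q^m, the identity s (j+1) + q s (j-1) = (1 + q) s j solves
  the recursion along the chain, starting from the leaves n - 1 and n. The pivot of 2 also accounts
  for the leaf 1, and the root pivot is what remains.\<close>

lemma tree_pivots_D:
  fixes q :: "'a::field"
  assumes n: "4 \<le> n" and q: "\<forall>m>0. q ^ m \<noteq> 1"
  shows "\<exists>a. tree_pivots n (D_parent n) [2, 2, n - 2] [1] q a"
proof -
  define s where "s m = 1 + q ^ m" for m
  have s_nz: "s m \<noteq> 0" if "m > 0" for m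
    unfolding s_def using q that by (rule power_plus_one_neq_0)
  have q_nz: "1 - q ^ m \<noteq> 0" if "m > 0" for m using q that by auto
  have s1: "s 1 = 1 + q" by (simp add: s_def)
  define a where "a m = (if m = 0 then (1 - q ^ 2) * (1 - q ^ (n - 2)) / s (n - 1)
    else if m = 1 \<or> m = n - 1 \<or> m = n then s 1
    else if m = 2 then s (n - 1) / (s 1 * s (n - 3))
    else s (n - m) / s (n - m - 1))" for m
  have a0: "a 0 = (1 - q ^ 2) * (1 - q ^ (n - 2)) / s (n - 1)" by (simp add: a_def)
  have a_leaf: "a m = s 1" if "m = 1 \<or> m = n - 1 \<or> m = n" for m using that n by (auto simp: a_def)
  have a2: "a 2 = s (n - 1) / (s 1 * s (n - 3))" using n by (auto simp: a_def)
  have a_chain: "a m = s (n - m) / s (n - m - 1)" if "3 \<le> m" "m \<le> n - 2" for m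
    using that by (auto simp: a_def)
  have nz: "a m \<noteq> 0" if "m \<in> {0..n}" for m
    using that n s_nz q_nz[of 2] q_nz[of "n - 2"] by (auto simp: a_def)
  obtain k where k: "n = k + 4" using n by (metis add.commute le_Suc_ex)
  have pivot: "a m + (\<Sum>u \<in> {u \<in> {1..n}. D_parent n u = m}. q / a u) = 1 + q" if m: "m \<in> {0..n}" for m
  proof -
    \<comment> \<open>For n = 4 the vertices 2 and n - 2 coincide and carry three leaves, which
      makes a separate case.\<close>
    consider "m = 0" | "m = 2" "n = 4" | "m = 2" "n > 4" | "m = 1 \<or> m = n - 1 \<or> m = n"
      | "3 \<le> m" "m = n - 2" | "3 \<le> m" "m < n - 2"
      using m n by force
    then show ?thesis
    proof cases
      case 1
      then have "{u \<in> {1..n}. D_parent n u = m} = {2}" using n by (auto simp: D_parent_def)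
      moreover have "(1 - q ^ 2) * (1 - q ^ (n - 2)) / s (n - 1) + q / (s (n - 1) / (s 1 * s (n - 3))) = 1 + q"
        using s_nz[of "n - 1"] n unfolding k
        by (simp add: divide_simps) (simp add: s_def algebra_simps eval_nat_numeral)
      ultimately show ?thesis using 1 by (simp add: a0 a2)
    next
      case 2
      then have "{u \<in> {1..n}. D_parent n u = m} = {1, 3, 4}" by (auto simp: D_parent_def)
      moreover have "s 3 / (s 1 * s 1) + 3 * q / s 1 = 1 + q"
        using s_nz[of 1] by (simp add: divide_simps) (simp add: s_def algebra_simps eval_nat_numeral)
      ultimately show ?thesis using 2 a2 by (simp add: a_leaf)
    next
      case 3
      then have "{u \<in> {1..n}. D_parent n u = m} = {1, 3}" by (auto simp: D_parent_def)
      moreover define j where "j = n - 5"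
      then have "n = j + 5" using 3 by simp
      then have "s (n - 1) / (s 1 * s (n - 3)) + (q / s 1 + q / (s (n - 3) / s (n - 4))) = 1 + q"
        using s_nz[of 1] s_nz[of "n - 3"] s_nz[of "n - 4"] n
        by (simp add: divide_simps) (simp add: s_def algebra_simps eval_nat_numeral)
      ultimately show ?thesis using 3 a2 a_leaf[of 1] a_chain[of 3] by simp
    next
      case 4
      then have empty: "{u \<in> {1..n}. D_parent n u = m} = {}" using n by (auto simp: D_parent_def)
      show ?thesis unfolding empty using 4 a_leaf s1 by simp
    next
      case 5
      then have "{u \<in> {1..n}. D_parent n u = m} = {n - 1, n}" by (auto simp: D_parent_def)
      moreover have "s 2 / s 1 + (q / s 1 + q / s 1) = 1 + q"
        using s_nz[of 1] by (simp add: divide_simps) (simp add: s_def algebra_simps eval_nat_numeral)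
      moreover have "n - 1 \<noteq> n" "n - m = 2" "n - m - 1 = 1" using 5 by auto
      ultimately show ?thesis using 5 a_chain[of m] a_leaf[of n] a_leaf[of "n - 1"] by simp
    next
      case 6
      then have "{u \<in> {1..n}. D_parent n u = m} = {Suc m}" by (auto simp: D_parent_def)
      moreover define j where "j = n - m - 3"
      then have j: "n - m = j + 3" using 6 by simp
      have "s (j + 3) / s (j + 2) + q / (s (j + 2) / s (j + 1)) = 1 + q"
        using s_nz[of "j + 3"] s_nz[of "j + 2"] s_nz[of "j + 1"]
        by (simp add: divide_simps) (simp add: s_def algebra_simps eval_nat_numeral)
      moreover have "n - m - 1 = j + 2" "n - Suc m = j + 2" "n - Suc m - 1 = j + 1" using j by auto
      ultimately show ?thesis using 6 j a_chain[of m] a_chain[of "Suc m"] by simp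
    qed
  qed
  \<comment> \<open>The quotients telescope; reflecting m to n + 1 - m prepares the induction on k =
    n - 4. For n = 4 the chain is empty and the value is 1.\<close>
  have "(\<Prod>m\<in>{3..n - 2}. a m) = s (n - 3) / s 1"
  proof -
    have "(\<Prod>m\<in>{3..n - 2}. a m) = (\<Prod>m\<in>{3..n - 2}. s (n - m) / s (n - m - 1))"
      by (rule prod.cong) (auto simp: a_chain)
    also have "\<dots> = (\<Prod>m\<in>{3..n - 2}. s (m - 1) / s (m - 2))"
      by (rule prod.reindex_bij_witness[where i = "\<lambda>m. n + 1 - m" and j = "\<lambda>m. n + 1 - m"])
         (auto simp: Suc_diff_le numeral_eq_Suc)
    also have "n - 2 = k + 2" using k by simp
    also have "(\<Prod>m\<in>{3..k + 2}. s (m - 1) / s (m - 2)) = s (k + 1) / s 1"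
    proof (induction k)
      case (Suc k)
      have "{3..Suc k + 2} = insert (k + 3) {3..k + 2}" by auto
      then show ?case using Suc s_nz[of "k + 1"] by simp
    qed (use s_nz[of 1] in simp)
    finally show ?thesis using k by simp
  qed
  moreover have "(\<Prod>m\<in>{0..n}. a m) = a 0 * (a 1 * (a 2 * (a (n - 1) * (a n * (\<Prod>m\<in>{3..n - 2}. a m)))))"
  proof -
    have "{0..k + 4} = insert 0 (insert 1 (insert 2 (insert (k + 3) (insert (k + 4) {3..k + 2}))))" by auto
    then show ?thesis by (simp add: k add.commute)
  qed
  ultimately have "(\<Prod>m\<in>{0..n}. a m) = a 0 * (a 1 * (a 2 * (a (n - 1) * (a n * (s (n - 3) / s 1)))))"
    by simp
  also have "\<dots> = (1 - q ^ 2) * (1 - q ^ (n - 2)) * s 1"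
    using s_nz[of "n - 1"] s_nz[of "n - 3"] s_nz[of 1] n by (simp add: a0 a2 a_leaf)
  finally have prod_a: "(\<Prod>m\<in>{0..n}. a m) = (1 - q ^ 2) * (1 - q ^ (n - 2)) * s 1" .
  have "(\<Prod>m\<in>{0..n}. a m) * (\<Prod>m\<leftarrow>[1]. 1 - q ^ m) = (\<Prod>m\<leftarrow>[2, 2, n - 2]. 1 - q ^ m)"
    unfolding prod_a by (simp add: s_def algebra_simps power2_eq_square)
  moreover have "a 0 * (1 + (\<Sum>m\<leftarrow>[2, 2, n - 2]. q ^ m / (1 - q ^ m)) - (\<Sum>m\<leftarrow>[1]. q ^ m / (1 - q ^ m))) = 1 - q"
    using q_nz[of 1] q_nz[of 2] q_nz[of "n - 2"] s_nz[of "n - 1"] unfolding k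
    by (simp add: a0 k divide_simps) (simp add: s_def algebra_simps eval_nat_numeral)
  ultimately show ?thesis using nz pivot unfolding tree_pivots_def by blast
qed

text \<open>
  Each pivot below is \<open>d(v) / \<Prod> d(u)\<close>, the product over the children \<open>u\<close> of \<open>v\<close>, where \<open>d(v)\<close>
  is the determinant for the branch hanging at \<open>v\<close>.
\<close>

lemma tree_pivots_E6:
  fixes q :: "'a::field"
  assumes q: "\<forall>m>0. q ^ m \<noteq> 1"
  shows "\<exists>a. tree_pivots 6 ((!) [0, 3, 0, 4, 2, 4, 5]) [2, 3, 3] [1] q a"
proof -
  define k1 where "k1 = 1 + q"
  define k2 where "k2 = 1 + q + q ^ 2"
  define p where "p = 1 - q ^ 2 + q ^ 4"
  define r where "r = 1 + q ^ 3"
  have q_nz: "1 - q \<noteq> 0" "1 - q ^ 2 \<noteq> 0" "1 - q ^ 3 \<noteq> 0"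
    using q[rule_format, of 1] q[rule_format, of 2] q[rule_format, of 3] by auto
  \<comment> \<open>\<open>p\<close> is the cyclotomic polynomial of order 12, hence a factor of 1 +
    q^6.\<close>
  have "p * (1 + q ^ 2) = 1 + q ^ 6" "k2 * (1 - q) = 1 - q ^ 3"
    by (simp_all add: p_def k2_def algebra_simps eval_nat_numeral)
  then have nz: "k1 \<noteq> 0" "k2 \<noteq> 0" "p \<noteq> 0" "r \<noteq> 0"
    using q_nz power_plus_one_neq_0[OF q, of 1] power_plus_one_neq_0[OF q, of 3] power_plus_one_neq_0[OF q, of 6] by (auto simp: k1_def r_def)
  \<comment> \<open>The branches at 3 and 5 have type A2 (\<open>k2\<close>), at 4 type A5
    (\<open>k2 * r\<close>), at 2 type E6 (\<open>k2 * p\<close>); common factors are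
    cancelled.\<close>
  define a where "a = (!) [(1 - q ^ 2) * (1 - q ^ 3) / p, k1, p / r, k2 / k1, r / k2, k2 / k1, k1]"
  have I: "{1..6} = {1, 2, 3, 4, 5, 6 :: nat}" "{0..6} = {0, 1, 2, 3, 4, 5, 6 :: nat}" by auto
  \<comment> \<open>The pivot equations with denominators cleared; the last relation matches the
    product of all pivots with the lists.\<close>
  have rel: "k1 = 1 + q" "k2 + q = k1 * k1" "r + q * k1 + q * k1 = k1 * k2" "p + q * k2 = r * k1" "(1 - q ^ 2) * (1 - q ^ 3) + q * r = k1 * p" "k2 * (1 - q) = 1 - q ^ 3"
    by (simp_all add: k1_def k2_def p_def r_def algebra_simps eval_nat_numeral)
  have "a m \<noteq> 0" if "m \<in> {0..6}" for m
    using that nz q_nz unfolding I by (auto simp: a_def)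
  moreover have "a m + (\<Sum>u \<in> {u \<in> {1..6}. [0, 3, 0, 4, 2, 4, 5] ! u = m}. q / a u) = 1 + q"
    if "m \<in> {0..6}" for m
  proof -
    have "a 0 + q / a 2 = k1"
      using nz q_nz by (simp add: a_def divide_simps) (use rel(5) in \<open>simp add: algebra_simps\<close>)
    moreover
    have "a 2 + q / a 4 = k1"
      using nz q_nz by (simp add: a_def divide_simps) (use rel(4) in \<open>simp add: algebra_simps\<close>)
    moreover
    have "a 3 + q / a 1 = k1"
      using nz q_nz by (simp add: a_def divide_simps) (use rel(2) in \<open>simp add: algebra_simps\<close>)
    moreover
    have "a 5 + q / a 6 = k1"
      using nz q_nz by (simp add: a_def divide_simps) (use rel(2) in \<open>simp add: algebra_simps\<close>)
    moreover
    have "a 4 + (q / a 3 + q / a 5) = k1"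
      using nz q_nz by (simp add: a_def divide_simps) (use rel(3) in \<open>simp add: algebra_simps\<close>)
    moreover
    have "a 1 = k1" "a 6 = k1" by (simp_all add: a_def)
    ultimately show ?thesis
      using that rel(1) unfolding sum.inter_filter[OF finite_atLeastAtMost] unfolding I by auto
  qed
  moreover have "(\<Prod>m\<in>{0..6}. a m) * (\<Prod>m\<leftarrow>[1]. 1 - q ^ m) = (\<Prod>m\<leftarrow>[2, 3, 3]. 1 - q ^ m)"
    using nz rel(6) unfolding I by (simp add: a_def divide_simps)
  moreover have "a 0 * (1 + (\<Sum>m\<leftarrow>[2, 3, 3]. q ^ m / (1 - q ^ m)) - (\<Sum>m\<leftarrow>[1]. q ^ m / (1 - q ^ m))) = 1 - q"
    using nz q_nz
    by (simp add: a_def divide_simps) (simp add: p_def algebra_simps eval_nat_numeral)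
  ultimately show ?thesis unfolding tree_pivots_def by blast
qed

lemma tree_pivots_E7:
  fixes q :: "'a::field"
  assumes q: "\<forall>m>0. q ^ m \<noteq> 1"
  shows "\<exists>a. tree_pivots 7 ((!) [0, 0, 4, 1, 3, 4, 5, 6]) [2, 3, 4] [1] q a"
proof -
  define k1 where "k1 = 1 + q"
  define k2 where "k2 = 1 + q + q ^ 2"
  define k3 where "k3 = 1 + q + q ^ 2 + q ^ 3"
  define k5 where "k5 = 1 + q + q ^ 2 + q ^ 3 + q ^ 4 + q ^ 5"
  define p where "p = 1 - q ^ 3 + q ^ 6"
  define r where "r = 1 + q ^ 5"
  have q_nz: "1 - q \<noteq> 0" "1 - q ^ 2 \<noteq> 0" "1 - q ^ 3 \<noteq> 0" "1 - q ^ 4 \<noteq> 0" "1 - q ^ 6 \<noteq> 0"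
    using q[rule_format, of 1] q[rule_format, of 2] q[rule_format, of 3] q[rule_format, of 4] q[rule_format, of 6] by auto
  have "p * (1 + q ^ 3) = 1 + q ^ 9" "k2 * (1 - q) = 1 - q ^ 3" "k3 * (1 - q) = 1 - q ^ 4" "k5 * (1 - q) = 1 - q ^ 6"
    by (simp_all add: p_def k2_def k3_def k5_def algebra_simps eval_nat_numeral)
  then have nz: "k1 \<noteq> 0" "k2 \<noteq> 0" "k3 \<noteq> 0" "k5 \<noteq> 0" "p \<noteq> 0" "r \<noteq> 0"
    using q_nz power_plus_one_neq_0[OF q, of 1] power_plus_one_neq_0[OF q, of 5] power_plus_one_neq_0[OF q, of 9] by (auto simp: k1_def r_def)
  \<comment> \<open>The branches at 7, 6, 5 have types A1, A2, A3, at 4 type A5 (\<open>k5\<close>),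
    at 3 type D6 (\<open>k1 * r\<close>), at 1 type E7 (\<open>k1 * p\<close>, with \<open>p\<close>
    cyclotomic of order 18).\<close>
  define a where "a = (!) [(1 - q ^ 3) * (1 - q ^ 4) / p, p / r, k1, k1 * r / k5, k5 / (k1 * k3), k3 / k2, k2 / k1, k1]"
  have I: "{1..7} = {1, 2, 3, 4, 5, 6, 7 :: nat}" "{0..7} = {0, 1, 2, 3, 4, 5, 6, 7 :: nat}" by auto
  have rel: "k1 = 1 + q" "k2 + q = k1 * k1" "k3 + q * k1 = k1 * k2" "k5 + q * k3 + q * k2 * k1 = k1 * k1 * k3" "k1 * r + k1 * q * k3 = k1 * k5" "p * k1 + q * k5 = k1 * k1 * r" "(1 - q ^ 3) * (1 - q ^ 4) + q * r = k1 * p" "k1 * (1 - q) = 1 - q ^ 2"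
    by (simp_all add: k1_def k2_def k3_def k5_def p_def r_def algebra_simps eval_nat_numeral)
  have "a m \<noteq> 0" if "m \<in> {0..7}" for m
    using that nz q_nz unfolding I by (auto simp: a_def)
  moreover have "a m + (\<Sum>u \<in> {u \<in> {1..7}. [0, 0, 4, 1, 3, 4, 5, 6] ! u = m}. q / a u) = 1 + q"
    if "m \<in> {0..7}" for m
  proof -
    have "a 0 + q / a 1 = k1"
      using nz q_nz by (simp add: a_def divide_simps) (use rel(7) in \<open>simp add: algebra_simps\<close>)
    moreover
    have "a 1 + q / a 3 = k1"
      using nz q_nz by (simp add: a_def divide_simps) (use rel(6) in \<open>simp add: algebra_simps\<close>)
    moreover
    have "a 3 + q / a 4 = k1"
      using nz q_nz by (simp add: a_def divide_simps) (use rel(5) in \<open>simp add: algebra_simps\<close>)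
    moreover
    have "a 4 + (q / a 2 + q / a 5) = k1"
      using nz q_nz by (simp add: a_def divide_simps) (use rel(4) in \<open>simp add: algebra_simps\<close>)
    moreover
    have "a 5 + q / a 6 = k1"
      using nz q_nz by (simp add: a_def divide_simps) (use rel(3) in \<open>simp add: algebra_simps\<close>)
    moreover
    have "a 6 + q / a 7 = k1"
      using nz q_nz by (simp add: a_def divide_simps) (use rel(2) in \<open>simp add: algebra_simps\<close>)
    moreover
    have "a 2 = k1" "a 7 = k1" by (simp_all add: a_def)
    ultimately show ?thesis
      using that rel(1) unfolding sum.inter_filter[OF finite_atLeastAtMost] unfolding I by auto
  qed
  moreover have "(\<Prod>m\<in>{0..7}. a m) * (\<Prod>m\<leftarrow>[1]. 1 - q ^ m) = (\<Prod>m\<leftarrow>[2, 3, 4]. 1 - q ^ m)"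
    using nz rel(8) unfolding I by (simp add: a_def divide_simps)
  moreover have "a 0 * (1 + (\<Sum>m\<leftarrow>[2, 3, 4]. q ^ m / (1 - q ^ m)) - (\<Sum>m\<leftarrow>[1]. q ^ m / (1 - q ^ m))) = 1 - q"
    using nz q_nz
    by (simp add: a_def divide_simps) (simp add: p_def algebra_simps eval_nat_numeral)
  ultimately show ?thesis unfolding tree_pivots_def by blast
qed

lemma tree_pivots_E8:
  fixes q :: "'a::field"
  assumes q: "\<forall>m>0. q ^ m \<noteq> 1"
  shows "\<exists>a. tree_pivots 8 ((!) [0, 3, 4, 4, 5, 6, 7, 8, 0]) [2, 3, 5] [1] q a"
proof -
  define k1 where "k1 = 1 + q"
  define k2 where "k2 = 1 + q + q ^ 2"
  define k4 where "k4 = 1 + q + q ^ 2 + q ^ 3 + q ^ 4"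
  define p where "p = 1 - q ^ 2 + q ^ 4"
  define r where "r = 1 - q ^ 3 + q ^ 6"
  define s where "s = 1 + q ^ 4"
  \<comment> \<open>the cyclotomic polynomial of order 30\<close>
  define w where "w = 1 + q - q ^ 3 - q ^ 4 - q ^ 5 + q ^ 7 + q ^ 8"
  have q_nz: "1 - q \<noteq> 0" "1 - q ^ 2 \<noteq> 0" "1 - q ^ 3 \<noteq> 0" "1 - q ^ 5 \<noteq> 0"
    using q[rule_format, of 1] q[rule_format, of 2] q[rule_format, of 3] q[rule_format, of 5] by auto
  \<comment> \<open>\<open>p\<close>, \<open>r\<close>, \<open>w\<close> are cyclotomic of orders
    12, 18, 30, hence divide 1 + q^6, 1 + q^9, 1 + q^15.\<close>
  have "p * (1 + q ^ 2) = 1 + q ^ 6" "r * (1 + q ^ 3) = 1 + q ^ 9" "w * (1 - q + q ^ 2 + q ^ 5 - q ^ 6 + q ^ 7) = 1 + q ^ 15" "k2 * (1 - q) = 1 - q ^ 3" "k4 * (1 - q) = 1 - q ^ 5"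
    by (simp_all add: p_def r_def w_def k2_def k4_def algebra_simps eval_nat_numeral)
  then have nz: "k1 \<noteq> 0" "k2 \<noteq> 0" "k4 \<noteq> 0" "p \<noteq> 0" "r \<noteq> 0" "s \<noteq> 0" "w \<noteq> 0"
    using q_nz power_plus_one_neq_0[OF q, of 1] power_plus_one_neq_0[OF q, of 4] power_plus_one_neq_0[OF q, of 6] power_plus_one_neq_0[OF q, of 9] power_plus_one_neq_0[OF q, of 15] by (auto simp: k1_def s_def)
  \<comment> \<open>From 4 up to 8 the branches have types A4, D5, E6, E7, E8 with determinants
    \<open>k4\<close>, \<open>k1 * s\<close>, \<open>k2 * p\<close>, \<open>k1 * r\<close>,
    \<open>w\<close>.\<close>
  define a where "a = (!) [k1 * ((1 - q ^ 3) * (1 - q ^ 5)) / w, k1, k1, k2 / k1, k4 / (k1 * k2), k1 * s / k4, k2 * p / (k1 * s), k1 * r / (k2 * p), w / (k1 * r)]"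
  have I: "{1..8} = {1, 2, 3, 4, 5, 6, 7, 8 :: nat}" "{0..8} = {0, 1, 2, 3, 4, 5, 6, 7, 8 :: nat}" by auto
  have rel: "k1 = 1 + q" "k2 + q = k1 * k1" "k4 + q * k2 + q * k1 * k1 = k1 * k1 * k2" "k1 * s + k1 * q * k2 = k1 * k4" "k2 * p + q * k4 = k1 * k1 * s" "k1 * r + k1 * q * s = k1 * k2 * p" "w + q * k2 * p = k1 * k1 * r" "k1 * ((1 - q ^ 3) * (1 - q ^ 5)) + k1 * q * r = k1 * w" "k1 * (1 - q) = 1 - q ^ 2"
    by (simp_all add: k1_def k2_def k4_def p_def r_def s_def w_def algebra_simps eval_nat_numeral)
  have "a m \<noteq> 0" if "m \<in> {0..8}" for m
    using that nz q_nz unfolding I by (auto simp: a_def)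
  moreover have "a m + (\<Sum>u \<in> {u \<in> {1..8}. [0, 3, 4, 4, 5, 6, 7, 8, 0] ! u = m}. q / a u) = 1 + q"
    if "m \<in> {0..8}" for m
  proof -
    have "a 0 + q / a 8 = k1"
      using nz q_nz by (simp add: a_def divide_simps) (use rel(8) in \<open>simp add: algebra_simps\<close>)
    moreover
    have "a 8 + q / a 7 = k1"
      using nz q_nz by (simp add: a_def divide_simps) (use rel(7) in \<open>simp add: algebra_simps\<close>)
    moreover
    have "a 7 + q / a 6 = k1"
      using nz q_nz by (simp add: a_def divide_simps) (use rel(6) in \<open>simp add: algebra_simps\<close>)
    moreover
    have "a 6 + q / a 5 = k1"
      using nz q_nz by (simp add: a_def divide_simps) (use rel(5) in \<open>simp add: algebra_simps\<close>)
    moreover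
    have "a 5 + q / a 4 = k1"
      using nz q_nz by (simp add: a_def divide_simps) (use rel(4) in \<open>simp add: algebra_simps\<close>)
    moreover
    have "a 4 + (q / a 2 + q / a 3) = k1"
      using nz q_nz by (simp add: a_def divide_simps) (use rel(3) in \<open>simp add: algebra_simps\<close>)
    moreover
    have "a 3 + q / a 1 = k1"
      using nz q_nz by (simp add: a_def divide_simps) (use rel(2) in \<open>simp add: algebra_simps\<close>)
    moreover
    have "a 1 = k1" "a 2 = k1" by (simp_all add: a_def)
    ultimately show ?thesis
      using that rel(1) unfolding sum.inter_filter[OF finite_atLeastAtMost] unfolding I by auto
  qed
  moreover have "(\<Prod>m\<in>{0..8}. a m) * (\<Prod>m\<leftarrow>[1]. 1 - q ^ m) = (\<Prod>m\<leftarrow>[2, 3, 5]. 1 - q ^ m)"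
    using nz rel(9) unfolding I by (simp add: a_def divide_simps)
  moreover have "a 0 * (1 + (\<Sum>m\<leftarrow>[2, 3, 5]. q ^ m / (1 - q ^ m)) - (\<Sum>m\<leftarrow>[1]. q ^ m / (1 - q ^ m))) = 1 - q"
    using nz q_nz
    by (simp add: a_def divide_simps) (simp add: k1_def w_def algebra_simps eval_nat_numeral)
  ultimately show ?thesis unfolding tree_pivots_def by blast
qed

section \<open>Adjacency matrices of extended Dynkin quivers\<close>

text \<open>What an arc and its reverse contribute to an entry depends only on the unordered
  endpoints (2 for a loop), so the entry is a sum of weights \<open>g\<close> over the edge
  multiset, which the labelling identifies.\<close>

lemma adjacency_double_quiver:
  fixes Q :: "('v::finite, 'e) pre_digraph" and f :: "'v \<Rightarrow> nat"
  assumes fin: "finite (arcs Q)" "finite S" and "inj f"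
    and edges: "image_mset ((`) f) (underlying_edges Q) = image_mset (\<lambda>i. {i, \<sigma> i}) (mset_set S)"
  shows "adjacency_matrix (double_quiver Q) = (graph_matrix S \<sigma> f :: 'a::semiring_1 ^ 'v ^ 'v)"
proof -
  have f_inj: "f i = f j \<longleftrightarrow> i = j" for i j using \<open>inj f\<close> by (auto simp: inj_def)
  have count: "card {a \<in> arcs (double_quiver Q). tail (double_quiver Q) a = i \<and> head (double_quiver Q) a = j}
      = of_bool (f i \<in> S \<and> f j = \<sigma> (f i)) + of_bool (f j \<in> S \<and> f i = \<sigma> (f j))" for i j
  proof -
    define g where "g e = (if e = {f i, f j} then if i = j then 2 else 1 else 0 :: nat)" for e
    have g: "g {x, y} = of_bool (x = f i \<and> y = f j) + of_bool (y = f i \<and> x = f j)" for x y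
      by (auto simp: g_def doubleton_eq_iff f_inj)
    let ?A = "{a \<in> arcs Q. tail Q a = i \<and> head Q a = j}" and ?B = "{a \<in> arcs Q. head Q a = i \<and> tail Q a = j}"
    have "{a \<in> arcs (double_quiver Q). tail (double_quiver Q) a = i \<and> head (double_quiver Q) a = j} = ?A <+> ?B"
      by (auto simp: double_quiver_def)
    then have "card {a \<in> arcs (double_quiver Q). tail (double_quiver Q) a = i \<and> head (double_quiver Q) a = j}
        = card ?A + card ?B"
      using fin by (simp add: card_Plus)
    also have "\<dots> = (\<Sum>a\<in>arcs Q. of_bool (tail Q a = i \<and> head Q a = j))
        + (\<Sum>a\<in>arcs Q. of_bool (head Q a = i \<and> tail Q a = j))"
      using fin by (simp add: of_bool_def sum.If_cases Int_def)
    also have "\<dots> = (\<Sum>a\<in>arcs Q. g {f (tail Q a), f (head Q a)})"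
      by (simp add: g f_inj sum.distrib)
    also have "\<dots> = \<Sum>\<^sub># (image_mset g (image_mset ((`) f) (underlying_edges Q)))"
      by (simp add: sum_unfold_sum_mset underlying_edges_def image_mset.compositionality o_def)
    also have "\<dots> = (\<Sum>i\<in>S. g {i, \<sigma> i})"
      by (simp add: edges sum_unfold_sum_mset image_mset.compositionality o_def)
    also have "\<dots> = (\<Sum>k\<in>S. (if k = f i then of_bool (\<sigma> (f i) = f j) else 0)
        + (if k = f j then of_bool (\<sigma> (f j) = f i) else 0))"
      unfolding g by (rule sum.cong) auto
    also have "\<dots> = of_bool (f i \<in> S \<and> f j = \<sigma> (f i)) + of_bool (f j \<in> S \<and> f i = \<sigma> (f j))"
      using fin by (auto simp: sum.distrib)
    finally show ?thesis .
  qed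
  show ?thesis
    unfolding adjacency_matrix_def graph_matrix_def count by (simp add: vec_eq_iff)
qed

section \<open>Edges of the extended diagrams in parent or successor form\<close>

lemma path_edges_eq_image:
  "path_edges a b = image_mset (\<lambda>i. {i, i - 1}) (mset_set {a<..b})"
proof -
  have "mset_set {a<..b} = image_mset Suc (mset_set {a..<b})"
    by (simp add: image_mset_mset_set flip: image_Suc_atLeastLessThan atLeastSucAtMost_greaterThanAtMost
        atLeastLessThanSuc_atLeastAtMost)
  then show ?thesis
    by (simp add: path_edges_def image_mset.compositionality o_def insert_commute)
qed

lemma extended_dynkin_edges_A:
  "extended_dynkin_edges (Type_A n) = image_mset (\<lambda>i. {i, Suc i mod Suc n}) (mset_set {0..n})"
proof (cases n)
  case 0
  then show ?thesis by (simp add: extended_dynkin_edges_def path_edges_def)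
next
  case (Suc m)
  \<comment> \<open>Vertices 0 and n give the extending edges, the others the path. For n = 1 the
    same edge occurs twice.\<close>
  have "{0..n} = insert 0 (insert n {1..<n})" using Suc by auto
  moreover have "image_mset (\<lambda>i. {i, Suc i mod Suc n}) (mset_set {1..<n}) = path_edges 1 n"
    unfolding path_edges_def by (rule image_mset_cong) auto
  ultimately show ?thesis using Suc
    by (simp add: extended_dynkin_edges_def insert_commute)
qed

lemma extended_dynkin_edges_D:
  assumes "4 \<le> n"
  shows "extended_dynkin_edges (Type_D n) = image_mset (\<lambda>i. {i, D_parent n i}) (mset_set {1..n})"
proof -
  have "{1..n} = insert 1 (insert 2 (insert n {2<..n - 1}))" using assms by auto
  moreover have "image_mset (\<lambda>i. {i, D_parent n i}) (mset_set {2<..n - 1})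
      = image_mset (\<lambda>i. {i, i - 1}) (mset_set {2<..n - 1})"
    by (rule image_mset_cong) (auto simp: D_parent_def)
  \<comment> \<open>The path edge {2, 1} becomes the parent edge of 1, since 2 carries the edge to
    0.\<close>
  moreover have "{1<..n - 1} = insert 2 {2<..n - 1}" using assms by auto
  ultimately show ?thesis using assms
    by (simp add: extended_dynkin_edges_def path_edges_eq_image D_parent_def insert_commute)
qed

lemma extended_dynkin_edges_E:
  "extended_dynkin_edges (Type_E 6) = image_mset (\<lambda>i. {i, [0, 3, 0, 4, 2, 4, 5] ! i}) (mset_set {1..6})"
  "extended_dynkin_edges (Type_E 7) = image_mset (\<lambda>i. {i, [0, 0, 4, 1, 3, 4, 5, 6] ! i}) (mset_set {1..7})"
  "extended_dynkin_edges (Type_E 8) = image_mset (\<lambda>i. {i, [0, 3, 4, 4, 5, 6, 7, 8, 0] ! i}) (mset_set {1..8})"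
proof -
  have "{1..6} = {1, 2, 3, 4, 5, 6 :: nat}" "{1..7} = {1, 2, 3, 4, 5, 6, 7 :: nat}"
    "{1..8} = {1, 2, 3, 4, 5, 6, 7, 8 :: nat}" "{3<..6} = {4, 5, 6 :: nat}"
    "{3<..7} = {4, 5, 6, 7 :: nat}" "{3<..8} = {4, 5, 6, 7, 8 :: nat}" by auto
  note I = this
  show "extended_dynkin_edges (Type_E 6) = image_mset (\<lambda>i. {i, [0, 3, 0, 4, 2, 4, 5] ! i}) (mset_set {1..6})"
    "extended_dynkin_edges (Type_E 7) = image_mset (\<lambda>i. {i, [0, 0, 4, 1, 3, 4, 5, 6] ! i}) (mset_set {1..7})"
    "extended_dynkin_edges (Type_E 8) = image_mset (\<lambda>i. {i, [0, 3, 4, 4, 5, 6, 7, 8, 0] ! i}) (mset_set {1..8})"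
    unfolding extended_dynkin_edges_def dynkin_edges.simps extending_edges.simps path_edges_eq_image I
    by (simp_all add: insert_commute)
qed

text \<open>The end of the case distinction: everything after it is uniform in the diagram. The
  field will be that of Laurent series.\<close>

lemma extended_dynkin_euler_type:
  fixes f :: "'n::finite \<Rightarrow> nat"
  assumes X: "valid_type X" and f: "bij_betw f UNIV {0..rank X}" "f v = 0"
  shows "\<exists>S \<sigma> ms ns. finite S \<and>
    extended_dynkin_edges X = image_mset (\<lambda>i. {i, \<sigma> i}) (mset_set S) \<and>
    (\<forall>m\<in>set ms \<union> set ns. m > 0) \<and>
    euler_type ms ns v (graph_matrix S \<sigma> f :: 'a::field ^ 'n ^ 'n)"
proof -
  have tree: "\<exists>S \<sigma> ms ns. finite S \<and>
      extended_dynkin_edges X = image_mset (\<lambda>i. {i, \<sigma> i}) (mset_set S) \<and>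
      (\<forall>m\<in>set ms \<union> set ns. m > 0) \<and>
      euler_type ms ns v (graph_matrix S \<sigma> f :: 'a ^ 'n ^ 'n)"
    if "extended_dynkin_edges X = image_mset (\<lambda>i. {i, \<sigma> i}) (mset_set {1..rank X})"
      "\<And>m. m \<in> {1..rank X} \<Longrightarrow> d (\<sigma> m) < (d m :: nat)"
      "\<And>q :: 'a. \<forall>m>0. q ^ m \<noteq> 1 \<Longrightarrow> \<exists>a. tree_pivots (rank X) \<sigma> ms ns q a"
      "\<forall>m\<in>set ms \<union> set ns. m > 0"
    for \<sigma> d ms ns
  proof (intro exI conjI)
    show "euler_type (map ((*) 2) ms) (map ((*) 2) ns) v (graph_matrix {1..rank X} \<sigma> f :: 'a ^ 'n ^ 'n)"
      by (rule euler_type_tree[where d = d, OF f]) (use that(2,3) in auto)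
  qed (use that(1,4) in auto)
  show ?thesis
  proof (cases X)
    case (Type_A n)
    show ?thesis
    proof (intro exI conjI)
      show "euler_type [Suc n, Suc n] [] v (graph_matrix {0..n} (\<lambda>m. Suc m mod Suc n) f :: 'a ^ 'n ^ 'n)"
        using f Type_A by (intro euler_type_cycle) auto
    qed (auto simp: Type_A extended_dynkin_edges_A)
  next
    case (Type_D n)
    with X have n: "4 \<le> n" by simp
    show ?thesis
    proof (rule tree)
      show "extended_dynkin_edges X = image_mset (\<lambda>i. {i, D_parent n i}) (mset_set {1..rank X})"
        using n by (simp add: Type_D extended_dynkin_edges_D)
      \<comment> \<open>Labels decrease towards the root except from 1 to 2; giving 1 the rank 3
        repairs this.\<close>
      show "(if D_parent n m = 1 then 3 else D_parent n m) < (if m = 1 then 3 else m)"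
        if "m \<in> {1..rank X}" for m
        using that n by (auto simp: Type_D D_parent_def)
      show "\<exists>a. tree_pivots (rank X) (D_parent n) [2, 2, n - 2] [1] q a" if "\<forall>m>0. q ^ m \<noteq> 1" for q :: 'a
        using tree_pivots_D[OF n that] by (simp add: Type_D)
    qed (use n in auto)
  next
    case (Type_E n)
    have I: "{1..6} = {1, 2, 3, 4, 5, 6 :: nat}" "{1..7} = {1, 2, 3, 4, 5, 6, 7 :: nat}"
      "{1..8} = {1, 2, 3, 4, 5, 6, 7, 8 :: nat}" by auto
    from X Type_E consider "n = 6" | "n = 7" | "n = 8" by auto
    then show ?thesis
    proof cases
      case 1
      show ?thesis
      proof (rule tree)
        show "extended_dynkin_edges X = image_mset (\<lambda>i. {i, [0, 3, 0, 4, 2, 4, 5] ! i}) (mset_set {1..rank X})"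
          unfolding Type_E 1 rank.simps by (rule extended_dynkin_edges_E)
        show "[0, 4, 1, 3, 2, 3, 4] ! ([0, 3, 0, 4, 2, 4, 5] ! m) < [0, 4, 1, 3, 2, 3, 4 :: nat] ! m" if "m \<in> {1..rank X}" for m
          using that unfolding Type_E 1 rank.simps I by auto
        show "\<exists>a. tree_pivots (rank X) ((!) [0, 3, 0, 4, 2, 4, 5]) [2, 3, 3] [1] q a" if "\<forall>m>0. q ^ m \<noteq> 1" for q :: 'a
          unfolding Type_E 1 rank.simps using that by (rule tree_pivots_E6)
      qed auto
    next
      case 2
      show ?thesis
      proof (rule tree)
        show "extended_dynkin_edges X = image_mset (\<lambda>i. {i, [0, 0, 4, 1, 3, 4, 5, 6] ! i}) (mset_set {1..rank X})"
          unfolding Type_E 2 rank.simps by (rule extended_dynkin_edges_E)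
        show "[0, 1, 4, 2, 3, 4, 5, 6] ! ([0, 0, 4, 1, 3, 4, 5, 6] ! m) < [0, 1, 4, 2, 3, 4, 5, 6 :: nat] ! m" if "m \<in> {1..rank X}" for m
          using that unfolding Type_E 2 rank.simps I by auto
        show "\<exists>a. tree_pivots (rank X) ((!) [0, 0, 4, 1, 3, 4, 5, 6]) [2, 3, 4] [1] q a" if "\<forall>m>0. q ^ m \<noteq> 1" for q :: 'a
          unfolding Type_E 2 rank.simps using that by (rule tree_pivots_E7)
      qed auto
    next
      case 3
      show ?thesis
      proof (rule tree)
        show "extended_dynkin_edges X = image_mset (\<lambda>i. {i, [0, 3, 4, 4, 5, 6, 7, 8, 0] ! i}) (mset_set {1..rank X})"
          unfolding Type_E 3 rank.simps by (rule extended_dynkin_edges_E)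
        \<comment> \<open>Vertex 1 has distance 7 from the root but rank 8; what matters is strict
          decrease towards the root.\<close>
        show "[0, 8, 6, 6, 5, 4, 3, 2, 1] ! ([0, 3, 4, 4, 5, 6, 7, 8, 0] ! m) < [0, 8, 6, 6, 5, 4, 3, 2, 1 :: nat] ! m" if "m \<in> {1..rank X}" for m
          using that unfolding Type_E 3 rank.simps I by auto
        show "\<exists>a. tree_pivots (rank X) ((!) [0, 3, 4, 4, 5, 6, 7, 8, 0]) [2, 3, 5] [1] q a" if "\<forall>m>0. q ^ m \<noteq> 1" for q :: 'a
          unfolding Type_E 3 rank.simps using that by (rule tree_pivots_E8)
      qed auto
    qed
  qed
qed

section \<open>The generating function of the Chebyshev-type polynomials\<close>

lemma poly_matrix_nth:
  fixes A :: "'a::comm_semiring_1 ^ 'n ^ 'n"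
  assumes "degree p \<le> N"
  shows "poly_matrix p A $ i $ j = (\<Sum>k\<le>N. coeff p k * matrix_power A k $ i $ j)"
proof -
  have "poly_matrix p A $ i $ j = (\<Sum>k\<le>degree p. coeff p k * matrix_power A k $ i $ j)"
    by (simp add: poly_matrix_def scale_matrix_def)
  also have "\<dots> = (\<Sum>k\<le>N. coeff p k * matrix_power A k $ i $ j)"
    using assms by (intro sum.mono_neutral_left) (auto simp: coeff_eq_0)
  finally show ?thesis .
qed

lemma poly_matrix_diff:
  fixes A :: "'a::comm_ring_1 ^ 'n ^ 'n"
  shows "poly_matrix (p - q) A = poly_matrix p A - poly_matrix q A"
proof -
  have "poly_matrix (p - q) A $ i $ j = poly_matrix p A $ i $ j - poly_matrix q A $ i $ j" for i j
    using poly_matrix_nth[of "p - q" "max (degree p) (degree q)" A i j]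
      poly_matrix_nth[of p "max (degree p) (degree q)" A i j]
      poly_matrix_nth[of q "max (degree p) (degree q)" A i j] degree_diff_le_max[of p q]
    by (simp add: left_diff_distrib sum_subtractf)
  then show ?thesis by (simp add: vec_eq_iff)
qed

lemma poly_matrix_pCons_0:
  fixes A :: "'a::comm_ring_1 ^ 'n ^ 'n"
  shows "poly_matrix (pCons 0 p) A = A ** poly_matrix p A"
proof -
  have "poly_matrix (pCons 0 p) A $ i $ j = (A ** poly_matrix p A) $ i $ j" for i j
  proof -
    have "poly_matrix (pCons 0 p) A $ i $ j
        = (\<Sum>k\<le>Suc (degree p). coeff (pCons 0 p) k * matrix_power A k $ i $ j)"
      by (rule poly_matrix_nth) (rule degree_pCons_le)
    also have "\<dots> = (\<Sum>k\<le>degree p. coeff p k * matrix_power A (Suc k) $ i $ j)"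
      by (simp add: sum.atMost_Suc_shift del: sum.atMost_Suc)
    also have "\<dots> = (\<Sum>k\<le>degree p. \<Sum>l\<in>UNIV. A $ i $ l * (coeff p k * matrix_power A k $ l $ j))"
      by (simp add: matrix_power_def matrix_matrix_mult_def sum_distrib_left mult_ac)
    also have "\<dots> = (A ** poly_matrix p A) $ i $ j"
      by (subst sum.swap) (simp add: matrix_matrix_mult_def poly_matrix_nth[OF order_refl] sum_distrib_left)
    finally show ?thesis .
  qed
  then show ?thesis by (simp add: vec_eq_iff)
qed

lemma poly_matrix_phi_rec:
  "poly_matrix (phi 0) A = scale_matrix 2 (mat 1)"
  "poly_matrix (phi (Suc 0)) A = A"
  "poly_matrix (phi (Suc (Suc k))) A = A ** poly_matrix (phi (Suc k)) A - poly_matrix (phi k) A"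
proof -
  show 0: "poly_matrix (phi 0) A = scale_matrix 2 (mat 1)"
    by (simp add: phi_eq_phi_rec poly_matrix_def matrix_power_def)
  have "poly_matrix [:1:] A = mat 1"
    by (simp add: poly_matrix_def matrix_power_def scale_matrix_def vec_eq_iff)
  then show "poly_matrix (phi (Suc 0)) A = A"
    by (simp add: phi_eq_phi_rec poly_matrix_pCons_0)
  show "poly_matrix (phi (Suc (Suc k))) A = A ** poly_matrix (phi (Suc k)) A - poly_matrix (phi k) A"
    by (simp add: phi_eq_phi_rec poly_matrix_diff poly_matrix_pCons_0)
qed

lemma chebyshev_matrix_mult_vec_nth:
  "(chebyshev_matrix t C *v w) $ i = (1 + t ^ 2) * w $ i - t * (\<Sum>j\<in>UNIV. C $ i $ j * w $ j)"
proof -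
  have "(chebyshev_matrix t C *v w) $ i
      = (\<Sum>j\<in>UNIV. (if j = i then (1 + t ^ 2) * w $ j else 0) - t * (C $ i $ j * w $ j))"
    unfolding matrix_vector_mult_def vec_lambda_beta
    by (rule sum.cong) (auto simp: chebyshev_matrix_def scale_matrix_def mat_def algebra_simps)
  then show ?thesis by (simp add: sum_subtractf sum_distrib_left)
qed

text \<open>From index 2 on the recursion makes every coefficient of A G vanish. Since phi 0 = 2,
  the remainder is 2 e_v - X c e_v, and subtracting A e_v leaves (1 - X^2) e_v.\<close>

lemma phi_generating_function:
  fixes c :: "complex ^ 'v ^ 'v" and v :: "'v::finite"
  defines "G \<equiv> \<chi> i. Abs_fps (\<lambda>k. poly_matrix (phi k) c $ i $ v)"
  shows "chebyshev_matrix fps_X (\<chi> i j. fps_const (c $ i $ j)) *v (G - axis v 1) = axis v (1 - fps_X ^ 2)"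
proof -
  let ?C = "\<chi> i j. fps_const (c $ i $ j)"
  have "(1 + fps_X ^ 2) * G $ i - fps_X * (\<Sum>j\<in>UNIV. ?C $ i $ j * G $ j)
      = 2 * of_bool (i = v) - fps_X * fps_const (c $ i $ v)" for i
  proof (rule fps_ext)
    fix k
    consider "k = 0" | "k = 1" | l where "k = Suc (Suc l)" by (metis One_nat_def not0_implies_Suc)
    then show "fps_nth ((1 + fps_X ^ 2) * G $ i - fps_X * (\<Sum>j\<in>UNIV. ?C $ i $ j * G $ j)) k
        = fps_nth (2 * of_bool (i = v) - fps_X * fps_const (c $ i $ v)) k"
    proof cases
      case 1
      then show ?thesis
        by (simp add: G_def poly_matrix_phi_rec scale_matrix_def mat_def)
    next
      case 2
      have "(\<Sum>j\<in>UNIV. c $ i $ j * (if j = v then 2 else 0)) = 2 * c $ i $ v"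
        by (simp add: if_distrib cong: if_cong)
      then show ?thesis using 2
        by (simp add: G_def poly_matrix_phi_rec scale_matrix_def mat_def fps_sum_nth
            fps_numeral_nth distrib_right fps_X_power_mult_nth if_distrib cong: if_cong)
    next
      case 3
      then show ?thesis
        by (simp add: G_def poly_matrix_phi_rec matrix_matrix_mult_def fps_sum_nth
            fps_numeral_nth distrib_right fps_X_power_mult_nth)
    qed
  qed
  moreover have "(\<Sum>j\<in>UNIV. ?C $ i $ j * axis v 1 $ j) = fps_const (c $ i $ v)" for i
    by (simp add: axis_def if_distrib cong: if_cong)
  ultimately have "(chebyshev_matrix fps_X ?C *v G - chebyshev_matrix fps_X ?C *v axis v 1) $ i
      = axis v (1 - fps_X ^ 2) $ i" for i
    by (simp add: chebyshev_matrix_mult_vec_nth axis_def algebra_simps)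
  then show ?thesis
    by (simp add: vec_eq_iff matrix_vector_mult_diff_distrib)
qed

text \<open>The geometric series X^m / (1 - X^m) has the indicator of the positive multiples of m as
  coefficients; this turns the sums in \<open>euler_type\<close> into divisor counts.\<close>

lemma fps_lambert:
  assumes "m > 0"
  defines "L \<equiv> Abs_fps (\<lambda>k. of_bool (k > 0 \<and> m dvd k) :: 'a::comm_ring_1)"
  shows "L * (1 - fps_X ^ m) = fps_X ^ m"
proof (rule fps_ext)
  fix k
  consider "k < m" | "k = m" | "k > m" by linarith
  then show "fps_nth (L * (1 - fps_X ^ m)) k = fps_nth (fps_X ^ m) k"
    by cases (use assms in \<open>auto simp: L_def right_diff_distrib fps_X_power_mult_right_nth fps_X_power_nth
      dvd_minus_self dest: dvd_imp_le\<close>)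
qed

section \<open>Passage to power series\<close>

lemma fps_to_fls_sum: "fps_to_fls (\<Sum>x\<in>S. F x :: 'a::comm_ring_1 fps) = (\<Sum>x\<in>S. fps_to_fls (F x))"
  by (induction S rule: infinite_finite_induct) auto

lemma fps_to_fls_sum_list: "fps_to_fls (\<Sum>x\<leftarrow>xs. F x :: 'a::comm_ring_1 fps) = (\<Sum>x\<leftarrow>xs. fps_to_fls (F x))"
  by (induction xs) auto

lemma fps_to_fls_prod_list: "fps_to_fls (\<Prod>x\<leftarrow>xs. F x :: 'a::comm_ring_1 fps) = (\<Prod>x\<leftarrow>xs. fps_to_fls (F x))"
  by (induction xs) (auto simp: fls_times_fps_to_fls)

lemma fps_to_fls_of_bool [simp]: "fps_to_fls (of_bool P :: 'a::comm_ring_1 fps) = of_bool P"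
  by (cases P) auto

text \<open>\<open>euler_type\<close> lives over a field, the theorem over power series; the
  injective embedding into Laurent series lets identities be pulled back.\<close>

lemma fls_chebyshev_graph_matrix:
  fixes t :: "'a::comm_ring_1 fps"
  shows "fps_to_fls (chebyshev_matrix t (graph_matrix S \<sigma> f) $ i $ j)
    = chebyshev_matrix (fps_to_fls t) (graph_matrix S \<sigma> f) $ i $ j"
  unfolding chebyshev_graph_matrix_nth by (simp add: fls_times_fps_to_fls fps_to_fls_power)

lemma fls_X_power_neq_1:
  assumes "r > 0"
  shows "\<forall>m>0. ((fls_X :: 'a::comm_ring_1 fls) ^ r) ^ m \<noteq> 1"
proof (intro allI impI)
  fix m :: nat assume "m > 0"
  have "(fls_X ^ r) ^ m = fps_to_fls ((fps_X :: 'a fps) ^ (r * m))"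
    by (simp add: fps_to_fls_power power_mult)
  moreover have "fps_nth ((fps_X :: 'a fps) ^ (r * m)) 0 = 0"
    using assms \<open>m > 0\<close> by (simp add: fps_X_power_nth)
  then have "(fps_X :: 'a fps) ^ (r * m) \<noteq> 1" by (metis fps_one_nth zero_neq_one)
  ultimately show "((fls_X :: 'a fls) ^ r) ^ m \<noteq> 1" by simp
qed

lemma euler_type_fps_det:
  assumes "euler_type ms ns v (graph_matrix S \<sigma> f :: complex fls ^ 'n::finite ^ 'n)"
  shows "det (chebyshev_matrix (fps_X ^ Suc r) (graph_matrix S \<sigma> f :: complex fps ^ 'n ^ 'n))
      * (\<Prod>m\<leftarrow>ns. 1 - fps_X ^ (m * Suc r)) = (\<Prod>m\<leftarrow>ms. 1 - fps_X ^ (m * Suc r))"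
proof -
  let ?C = "graph_matrix S \<sigma> f :: complex fps ^ 'n ^ 'n"
  have pow: "(fls_X ^ Suc r) ^ m = fps_to_fls ((fps_X :: complex fps) ^ (m * Suc r))" for m
    unfolding mult.commute[of m] by (simp only: fps_to_fls_power fps_X_to_fls power_mult)
  have "fps_to_fls (det (chebyshev_matrix (fps_X ^ Suc r) ?C))
      = det (chebyshev_matrix (fls_X ^ Suc r) (graph_matrix S \<sigma> f))"
    by (subst det_map_hom[symmetric])
       (auto simp: fls_times_fps_to_fls fls_chebyshev_graph_matrix fps_to_fls_power vec_lambda_eta simp del: power_Suc)
  moreover have "det (chebyshev_matrix (fls_X ^ Suc r) (graph_matrix S \<sigma> f :: complex fls ^ 'n ^ 'n))
      * (\<Prod>m\<leftarrow>ns. 1 - (fls_X ^ Suc r) ^ m) = (\<Prod>m\<leftarrow>ms. 1 - (fls_X ^ Suc r) ^ m)"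
    using assms fls_X_power_neq_1[of "Suc r"] unfolding euler_type_def by blast
  ultimately have "fps_to_fls (det (chebyshev_matrix (fps_X ^ Suc r) ?C)
      * (\<Prod>m\<leftarrow>ns. 1 - fps_X ^ (m * Suc r))) = fps_to_fls (\<Prod>m\<leftarrow>ms. 1 - fps_X ^ (m * Suc r))"
    unfolding pow by (simp add: fls_times_fps_to_fls fps_to_fls_prod_list del: power_Suc)
  then show ?thesis unfolding fps_to_fls_eq_iff .
qed

text \<open>Evaluate \<open>euler_type\<close> at t = X, with w the generating vector minus e_v, and
  compare coefficients of X^(k+1).\<close>

lemma euler_type_phi_entry:
  assumes "euler_type ms ns v (graph_matrix S \<sigma> f :: complex fls ^ 'n::finite ^ 'n)"
    and pos: "\<forall>m\<in>set ms \<union> set ns. m > 0"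
  shows "phi_entry (Suc k) (graph_matrix S \<sigma> f) v
    = int (length (filter (\<lambda>m. m dvd Suc k) ms)) - int (length (filter (\<lambda>m. m dvd Suc k) ns))"
proof -
  let ?c = "graph_matrix S \<sigma> f :: complex ^ 'n ^ 'n"
  define G :: "complex fps ^ 'n" where "G = (\<chi> i. Abs_fps (\<lambda>k. poly_matrix (phi k) ?c $ i $ v))"
  define L where "L m = (Abs_fps (\<lambda>k. of_bool (k > 0 \<and> m dvd k)) :: complex fps)" for m
  define w where "w = (\<chi> i. fps_to_fls ((G - axis v 1) $ i))"
  have "(\<chi> i j. fps_const (?c $ i $ j)) = (graph_matrix S \<sigma> f :: complex fps ^ 'n ^ 'n)"
    by (simp add: graph_matrix_def vec_eq_iff)
  then have gf: "chebyshev_matrix fps_X (graph_matrix S \<sigma> f) *v (G - axis v 1) = axis v (1 - fps_X ^ 2)"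
    using phi_generating_function[of ?c v] by (simp add: G_def)
  have "chebyshev_matrix fls_X (graph_matrix S \<sigma> f) *v w = axis v (1 - fls_X ^ 2)"
  proof -
    have "(chebyshev_matrix fls_X (graph_matrix S \<sigma> f) *v w) $ i
        = fps_to_fls ((chebyshev_matrix fps_X (graph_matrix S \<sigma> f) *v (G - axis v 1)) $ i)" for i
      unfolding matrix_vector_mult_def vec_lambda_beta fps_to_fls_sum fls_times_fps_to_fls
        fls_chebyshev_graph_matrix w_def by simp
    then show ?thesis unfolding gf by (simp add: vec_eq_iff axis_def fps_to_fls_power)
  qed
  moreover have "\<forall>m>0. (fls_X :: complex fls) ^ m \<noteq> 1"
    using fls_X_power_neq_1[of 1] by simp
  ultimately have w: "w $ v = 1 + (\<Sum>m\<leftarrow>ms. fls_X ^ m / (1 - fls_X ^ m)) - (\<Sum>m\<leftarrow>ns. fls_X ^ m / (1 - fls_X ^ m))"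
    using assms(1) unfolding euler_type_def by blast
  have L: "fls_X ^ m / (1 - fls_X ^ m) = fps_to_fls (L m)" if "m > 0" for m
  proof -
    have "fps_to_fls (L m * (1 - fps_X ^ m)) = fps_to_fls (fps_X ^ m)"
      unfolding L_def fps_lambert[OF that] ..
    moreover have "(1 :: complex fls) - fls_X ^ m \<noteq> 0"
      using \<open>\<forall>m>0. (fls_X :: complex fls) ^ m \<noteq> 1\<close> that by auto
    ultimately show ?thesis
      by (simp add: fls_times_fps_to_fls fps_to_fls_power nonzero_divide_eq_eq)
  qed
  have sum_L: "(\<Sum>m\<leftarrow>xs. fls_X ^ m / (1 - fls_X ^ m)) = fps_to_fls (\<Sum>m\<leftarrow>xs. L m)"
    if "\<forall>m\<in>set xs. m > 0" for xs
    unfolding fps_to_fls_sum_list using that L by (intro arg_cong[of _ _ sum_list] map_cong) auto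
  have "fps_to_fls (G $ v - 1) = fps_to_fls (1 + (\<Sum>m\<leftarrow>ms. L m) - (\<Sum>m\<leftarrow>ns. L m))"
    using w sum_L[of ms] sum_L[of ns] pos by (simp add: w_def axis_def)
  then have "G $ v - 1 = 1 + (\<Sum>m\<leftarrow>ms. L m) - (\<Sum>m\<leftarrow>ns. L m)"
    unfolding fps_to_fls_eq_iff .
  then have "fps_nth (G $ v - 1) (Suc k) = fps_nth (1 + (\<Sum>m\<leftarrow>ms. L m) - (\<Sum>m\<leftarrow>ns. L m)) (Suc k)"
    by simp
  moreover have "fps_nth (\<Sum>m\<leftarrow>xs. L m) (Suc k) = of_nat (length (filter (\<lambda>m. m dvd Suc k) xs))" for xs
    by (induction xs) (auto simp: L_def)
  ultimately have "poly_matrix (phi (Suc k)) ?c $ v $ v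
      = of_int (int (length (filter (\<lambda>m. m dvd Suc k) ms)) - int (length (filter (\<lambda>m. m dvd Suc k) ns)))"
    by (simp add: G_def)
  \<comment> \<open>Integrality of the entries brings the comparison from the complex numbers down
    to the integers.\<close>
  moreover have "of_int (phi_entry (Suc k) ?c v) = poly_matrix (phi (Suc k)) ?c $ v $ v"
    by (rule of_int_phi_entry) (simp add: graph_matrix_def)
  ultimately show ?thesis by (metis of_int_eq_iff)
qed

section \<open>Assembling the product formula\<close>

theorem mainTheorem4:
  fixes Q :: "('v::finite, 'e) pre_digraph" and v\<^sub>0 :: 'v
    and \<c> :: "complex ^ 'v ^ 'v" and \<c>\<^sub>t :: "complex fps ^ 'v ^ 'v"
  assumes "verts Q = UNIV"
    and "extended_dynkin_quiver Q"
    and "extending_vertex Q v\<^sub>0"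
  defines "\<c> \<equiv> adjacency_matrix (double_quiver Q)"
    and "\<c>\<^sub>t \<equiv> adjacency_matrix (double_quiver Q)"
  shows "\<exists>P :: complex fps.
    (\<lambda>r. det (mat 1 - scale_matrix (fps_X ^ Suc r) \<c>\<^sub>t + scale_matrix (fps_X ^ (2 * Suc r)) (mat 1)))
      has_prod P \<and>
    (\<lambda>k. (1 - fps_X ^ Suc k) powi phi_entry (Suc k) \<c> v\<^sub>0) has_prod P"
proof -
  have fin: "finite (arcs Q)"
    using assms(2) by (auto simp: extended_dynkin_quiver_def intro: fin_digraph.finite_arcs)
  \<comment> \<open>This labelling is chosen so that the extending vertex is the root 0.\<close>
  obtain X f where X: "extended_dynkin_labelling Q X f" and v: "f v\<^sub>0 = 0"
    using assms(3) by (auto simp: extending_vertex_def)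
  then have valid: "valid_type X" and f: "bij_betw f UNIV {0..rank X}"
    and edges: "image_mset ((`) f) (underlying_edges Q) = extended_dynkin_edges X"
    using assms(1) by (auto simp: extended_dynkin_labelling_def)
  obtain S \<sigma> ms ns where S: "finite S"
    and \<sigma>: "extended_dynkin_edges X = image_mset (\<lambda>i. {i, \<sigma> i}) (mset_set S)"
    and pos: "\<forall>m\<in>set ms \<union> set ns. m > 0"
    and euler: "euler_type ms ns v\<^sub>0 (graph_matrix S \<sigma> f :: complex fls ^ 'v ^ 'v)"
    using extended_dynkin_euler_type[OF valid f v] by blast
  have "inj f" using f by (simp add: bij_betw_def)
  note adj = adjacency_double_quiver[OF fin S this edges[unfolded \<sigma>]]
  have c: "\<c> = graph_matrix S \<sigma> f" and c\<^sub>t: "\<c>\<^sub>t = graph_matrix S \<sigma> f"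
    unfolding \<c>_def \<c>\<^sub>t_def by (rule adj)+
  have det: "det (mat 1 - scale_matrix (fps_X ^ Suc r) \<c>\<^sub>t + scale_matrix (fps_X ^ (2 * Suc r)) (mat 1))
      = det (chebyshev_matrix (fps_X ^ Suc r) (graph_matrix S \<sigma> f :: complex fps ^ 'v ^ 'v))" for r
    by (simp only: chebyshev_matrix_def c\<^sub>t mult.commute[of 2] power_mult)
  show ?thesis
    unfolding det c
    by (rule has_prod_euler_exchange[OF _ _ euler_type_fps_det[OF euler] euler_type_phi_entry[OF euler pos]])
       (use pos in auto)
qed

end
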